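(* Let $Z(\hbar,j)=Z^{\varphi^3}(\hbar,j)$ be the partition function of zero-dimensional $\varphi^3$-theory. For each fixed $m\ge 0$, the series $\partial_j^m Z(\hbar,j)|_{j=0}$ has a factorial asymptotic expansion with $A=\frac23$, and, coefficientwise in $j$, $$\mathcal{A}^{\frac23}_\hbar Z(\hbar,j)=\frac{1}{2\pi}\,e^{\frac{1-(1-2j)^{3/2}+3j}{3\hbar}}\,\frac{1}{(1-2j)^{1/4}}\,Z_0\!\left(-\frac{\hbar}{(1-2j)^{3/2}}\right),$$ where $Z_0(\hbar)=Z(\hbar,0)$. In particular, $\mathcal{A}^{\frac23}_\hbar Z_0(\hbar)=\frac1{2\pi}Z_0(-\hbar)$, and, writing $z_{m,n}=[\hbar^n]\,\partial_j^mZ(\hbar,j)|_{j=0}$, for all $R\ge0$ as $n\to\infty$ $$z_{m,n}=\sum_{k=0}^{R-1}c_{m,k}\left(\tfrac23\right)^{-m-n+k}\Gamma(n+m-k)+\mathcal{O}\left(\left(\tfrac23\right)^{-m-n+R}\Gamma(n+m-R)\right),$$ with $c_{m,k}=[\hbar^k]\,\hbar^m\,\mathcal{A}^{\frac23}_\hbar\partial_j^mZ(\hbar,j)|_{j=0}$; explicitly, to the first orders, $$z_{m,n}\sim\frac{2^m}{2\pi}\left(\tfrac23\right)^{-m-n}\Gamma(n+m)\left(1+\tfrac23\left(-\tfrac{5}{24}+\tfrac{3m}{8}-\tfrac{m^2}{8}\right)\frac{1}{n+m-1}+\cdots\right).$$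
   Context: Partition function: $Z_0(\hbar)=\sum_{n\ge0}\hbar^n\frac{(6n-1)!!}{(3!)^{2n}(2n)!}$ and $$Z(\hbar,j)=e^{\frac{(1-2j)^{3/2}-1+3j}{3\hbar}}\frac{1}{(1-2j)^{1/4}}Z_0\!\left(\frac{\hbar}{(1-2j)^{3/2}}\right),$$ which is the formal perturbative expansion of $\int\frac{dx}{\sqrt{2\pi\hbar}}e^{\frac1\hbar(-\frac{x^2}{2}+\frac{x^3}{3!}+xj)}$. It is a power series in $j$ whose coefficients are Laurent series in $\hbar$ with finitely many negative powers. Asymptotic operator: a power (or Laurent, with finitely many negative powers) series $f(\hbar)=\sum_n f_n\hbar^n$ has a factorial asymptotic expansion with parameter $A>0$ if there are $\beta\in\mathbb{R}$ and $c_k\in\mathbb{R}$ with $f_n=\sum_{k=0}^{R-1}c_kA^{-n-\beta+k}\Gamma(n+\beta-k)+\mathcal{O}(A^{-n}\Gamma(n+\beta-R))$ as $n\to\infty$ for all $R\ge0$. Then $(\mathcal{A}^A_\hbar f)(\hbar):=\hbar^{-\beta}\sum_{k\ge0}c_k\hbar^k$. For series in $j$ with coefficients in $\hbar$, $\mathcal{A}^A_\hbar$ acts on each coefficient of $j^m$. *)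

theory Defs
  imports
    "HOL-Analysis.Analysis"
    "HOL-Computational_Algebra.Computational_Algebra"
    "HOL-Library.Landau_Symbols"
begin

text \<open>
  Series in \<open>\<hbar>\<close> are \<open>real fps\<close> or \<open>real fls\<close>; a series in \<open>j\<close> whose coefficients are Laurent
  series in \<open>\<hbar>\<close> with finitely many negative powers is a \<open>real fls fps\<close>
  (outer variable \<open>j\<close>, inner variable \<open>\<hbar>\<close>).
\<close>

section \<open>The partition function\<close>

text \<open>Truncated subtraction turns \<open>(6 * n - 1)!!\<close> at \<open>n = 0\<close> into \<open>0!! = 1\<close>, which agrees with the
  convention \<open>(-1)!! = 1\<close>.\<close>

fun double_fact :: "nat \<Rightarrow> nat" where
  "double_fact 0 = 1"
| "double_fact (Suc 0) = 1"
| "double_fact (Suc (Suc n)) = Suc (Suc n) * double_fact n"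

definition Z0 :: "real fps" where
  "Z0 = Abs_fps (\<lambda>n. real (double_fact (6 * n - 1)) / (fact 3 ^ (2 * n) * fact (2 * n)))"

text \<open>\<open>(1 - 2j)\<^sup>a\<close> as a power series in \<open>j\<close>\<close>

definition one_minus_2j_powr :: "real \<Rightarrow> real fps" where
  "one_minus_2j_powr a = fps_compose (fps_binomial a) (- 2 * fps_X)"

definition series_in_j :: "real fps \<Rightarrow> real fls fps" where
  "series_in_j g = Abs_fps (\<lambda>m. fls_const (fps_nth g m))"

text \<open>\<open>F(\<hbar> g(j))\<close>, expanded in \<open>j\<close>: the coefficient of \<open>j\<^sup>m \<hbar>\<^sup>n\<close> is \<open>F\<^sub>n [j\<^sup>m] g(j)\<^sup>n\<close>.\<close>

definition subst_hbar_times :: "real fps \<Rightarrow> real fps \<Rightarrow> real fls fps" where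
  "subst_hbar_times F g =
     Abs_fps (\<lambda>m. fps_to_fls (Abs_fps (\<lambda>n. fps_nth F n * fps_nth (g ^ n) m)))"

text \<open>\<open>exp (g(j) / (3\<hbar>))\<close>, meaningful for \<open>g(0) = 0\<close>\<close>

definition exp_over_3hbar :: "real fps \<Rightarrow> real fls fps" where
  "exp_over_3hbar g = fps_compose (fps_exp 1) (fps_const (1 / (3 * fls_X)) * series_in_j g)"

definition Z_phi3 :: "real fls fps" where
  "Z_phi3 = exp_over_3hbar (one_minus_2j_powr (3/2) - 1 + 3 * fps_X)
       * series_in_j (inverse (one_minus_2j_powr (1/4)))
       * subst_hbar_times Z0 (inverse (one_minus_2j_powr (3/2)))"

text \<open>\<open>\<partial>\<^sub>j\<^sup>m Z_phi3\<close> at \<open>j = 0\<close>, and its coefficient of \<open>\<hbar>\<^sup>n\<close>\<close>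

definition Z_phi3_deriv0 :: "nat \<Rightarrow> real fls" where
  "Z_phi3_deriv0 m = fps_nth (fps_nth_deriv m Z_phi3) 0"

definition z_phi3 :: "nat \<Rightarrow> nat \<Rightarrow> real" where
  "z_phi3 m n = fls_nth (Z_phi3_deriv0 m) (int n)"

section \<open>Factorial asymptotic expansions\<close>

definition factorial_expansion :: "real \<Rightarrow> real fls \<Rightarrow> real \<Rightarrow> (nat \<Rightarrow> real) \<Rightarrow> bool" where
  "factorial_expansion A f \<beta> c \<longleftrightarrow> A > 0 \<and>
     (\<forall>R. (\<lambda>n. fls_nth f (int n)
              - (\<Sum>k<R. c k * A powr (- real n - \<beta> + real k) * Gamma (real n + \<beta> - real k)))
           \<in> O(\<lambda>n. A powr (- real n) * Gamma (real n + \<beta> - real R)))"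

definition has_factorial_expansion :: "real \<Rightarrow> real fls \<Rightarrow> bool" where
  "has_factorial_expansion A f \<longleftrightarrow> (\<exists>\<beta> c. factorial_expansion A f \<beta> c)"

text \<open>
  Since \<open>\<beta>\<close> is an arbitrary real number, \<open>\<hbar>\<^bsup>-\<beta>\<^esup> \<Sum> c\<^sub>k \<hbar>\<^sup>k\<close> is a series with real exponents. It is
  represented by the function mapping an exponent to its coefficient. Different pairs of \<open>\<beta>\<close> and \<open>c\<close>
  can represent the same expansion (e.g. \<open>\<beta> + 1\<close> with \<open>c\<close> shifted by one), but the resulting
  series is the same, so the asymptotic operator is given by a definite description.
\<close>

type_synonym real_exp_series = "real \<Rightarrow> real"

definition real_exp_series_of :: "real fls \<Rightarrow> real_exp_series" where
  "real_exp_series_of f = (\<lambda>e. if e \<in> \<int> then fls_nth f \<lfloor>e\<rfloor> else 0)"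

definition hbar_powr_times :: "real \<Rightarrow> real_exp_series \<Rightarrow> real_exp_series" where
  "hbar_powr_times s g = (\<lambda>e. g (e - s))"

definition asymp_op :: "real \<Rightarrow> real fls \<Rightarrow> real_exp_series" where
  "asymp_op A f = (THE g. \<exists>\<beta> c. factorial_expansion A f \<beta> c \<and>
     g = hbar_powr_times (- \<beta>) (real_exp_series_of (fps_to_fls (Abs_fps c))))"

definition asymp_op_j :: "real \<Rightarrow> real fls fps \<Rightarrow> nat \<Rightarrow> real_exp_series" where
  "asymp_op_j A F = (\<lambda>m. asymp_op A (fps_nth F m))"

definition c_coeff :: "nat \<Rightarrow> nat \<Rightarrow> real" where
  "c_coeff m k = hbar_powr_times (real m) (asymp_op (2/3) (Z_phi3_deriv0 m)) (real k)"

end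

theory Submission
  imports Defs "HOL-Real_Asymp.Real_Asymp"
begin

text \<open>
  The operator of the asymptotic expansion is linear and commutes with division by \<open>\<hbar>\<close>. Both \<open>Z\<close> and
  the right-hand side satisfy the Airy-type equation
  \<open>\<hbar>\<^sup>2 \<partial>\<^sub>j\<^sup>2 F - 2 \<hbar> \<partial>\<^sub>j F + 2 j F = 0\<close>, being the contributions of the two saddle points of the same integral, so their
  Taylor coefficients in \<open>j\<close> obey the same recurrence and it suffices to expand the coefficients of
  \<open>j\<^sup>0\<close> and \<open>j\<^sup>1\<close>. The latter is obtained from the former by \<open>1/2 + 3 \<hbar> d/d\<hbar>\<close>. For \<open>j\<^sup>0\<close>, the numbers
  \<open>p\<^sub>n = (2/3)\<^sup>n [\<hbar>\<^sup>n] Z0\<close> satisfy \<open>(n + 1) p\<^sub>n\<^sub>+\<^sub>1 = (n + 1/6)(n + 5/6) p\<^sub>n\<close>. The sums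
  \<open>\<Sum>\<^sub>k\<^sub><\<^sub>R (-1)\<^sup>k p\<^sub>k \<Gamma>(n - k)\<close> satisfy it up to an explicit multiple of \<open>\<Gamma>(n + 1 - R)\<close>; so their quotient by
  \<open>p\<^sub>n\<close> converges with telescoping error of order \<open>\<Gamma>(n - R) / \<Gamma>(n)\<close>, and the limit comes from the
  reflection formula \<open>\<Gamma>(1/6) \<Gamma>(5/6) = 2\<pi>\<close>.
\<close>

section \<open>Ratios of Gamma values\<close>

text \<open>The quotient of the two \<open>Gamma_series'\<close> terms is
  \<open>n^(p - q) * pochhammer q n / pochhammer p n\<close> and has a nonzero limit. So the ratio
  of the rising factorials behaves like \<open>n^(p - q)\<close>, which tends to 0.\<close>

lemma Gamma_ratio_tendsto_0_pos:
  fixes p q :: real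
  assumes "0 < p" "p < q"
  shows "(\<lambda>n. Gamma (real n + p) / Gamma (real n + q)) \<longlonglongrightarrow> 0"
proof -
  have ints: "p \<notin> \<int>\<^sub>\<le>\<^sub>0" "q \<notin> \<int>\<^sub>\<le>\<^sub>0"
    using assms by (auto elim!: nonpos_Ints_cases)
  have Gpos: "Gamma p > 0" "Gamma q > 0"
    using assms by (auto intro: Gamma_real_pos)
  have "(\<lambda>n. exp ((p - q) * ln (real n)) / (Gamma_series' p n / Gamma_series' q n)) \<longlonglongrightarrow>
          0 / (Gamma p / Gamma q)"
  proof (intro tendsto_divide Gamma_series'_LIMSEQ)
    show "(\<lambda>n. exp ((p - q) * ln (real n))) \<longlonglongrightarrow> 0"
    proof (rule filterlim_compose[OF exp_at_bot])
      show "LIM n sequentially. (p - q) * ln (real n) :> at_bot"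
        using assms
        by (intro filterlim_tendsto_neg_mult_at_bot[OF tendsto_const]
              filterlim_compose[OF ln_at_top] filterlim_real_sequentially) auto
    qed
  qed (use Gpos in auto)
  hence lim: "(\<lambda>n. Gamma p / Gamma q *
      (exp ((p - q) * ln (real n)) / (Gamma_series' p n / Gamma_series' q n))) \<longlonglongrightarrow> 0"
    by (intro tendsto_mult_right_zero) simp
  have eq: "Gamma p / Gamma q * (exp ((p - q) * ln (real n)) / (Gamma_series' p n / Gamma_series' q n))
       = Gamma (real n + p) / Gamma (real n + q)" for n
  proof -
    have "pochhammer p n > 0" "pochhammer q n > 0"
      using assms by (auto intro: pochhammer_pos)
    moreover have "Gamma (real n + p) = pochhammer p n * Gamma p"
      "Gamma (real n + q) = pochhammer q n * Gamma q"
      using pochhammer_Gamma[OF ints(1), of n] pochhammer_Gamma[OF ints(2), of n] Gpos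
      by (simp_all add: add.commute)
    ultimately show ?thesis using Gpos
      by (simp add: Gamma_series'_def divide_simps left_diff_distrib exp_diff)
  qed
  show ?thesis using lim unfolding eq .
qed

lemma Gamma_ratio_tendsto_0:
  fixes a b :: real
  assumes "a < b"
  shows "(\<lambda>n. Gamma (real n + a) / Gamma (real n + b)) \<longlonglongrightarrow> 0"
proof -
  \<comment> \<open>An index shift by \<open>N\<close> makes both arguments of \<open>Gamma\<close>
    positive.\<close>
  obtain N :: nat where N: "real N > - a"
    using reals_Archimedean2 by blast
  have "(\<lambda>n. Gamma (real n + (real N + a)) / Gamma (real n + (real N + b))) \<longlonglongrightarrow> 0"
    using assms N by (intro Gamma_ratio_tendsto_0_pos) auto
  hence "(\<lambda>n. Gamma (real (n + N) + a) / Gamma (real (n + N) + b)) \<longlonglongrightarrow> 0"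
    by (simp add: add.assoc)
  thus ?thesis by (rule LIMSEQ_offset)
qed

lemma eventually_Gamma_pos: "eventually (\<lambda>n. Gamma (real n + a) > 0) sequentially"
proof -
  have "eventually (\<lambda>n. real n > - a) sequentially"
    using filterlim_real_sequentially by (auto simp: filterlim_at_top_dense)
  thus ?thesis by eventually_elim (auto intro: Gamma_real_pos)
qed

lemma Gamma_smallo:
  assumes "a < b"
  shows "(\<lambda>n. Gamma (real n + a)) \<in> o(\<lambda>n. Gamma (real n + b))"
proof (rule smalloI_tendsto)
  show "eventually (\<lambda>n. Gamma (real n + b) \<noteq> 0) sequentially"
    using eventually_Gamma_pos[of b] by eventually_elim auto
qed (rule Gamma_ratio_tendsto_0[OF assms])

lemma Gamma_real_step:
  fixes x :: real
  assumes "x > 0"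
  shows "Gamma (x + 1) = x * Gamma x"
  using assms by (intro Gamma_plus1) (auto elim!: nonpos_Ints_cases)

section \<open>The coefficients of \<open>Z0\<close>\<close>

lemma double_fact_step:
  "double_fact (6 * Suc n - 1) = (6*n+5) * (6*n+3) * (6*n+1) * double_fact (6*n-1)"
\<comment> \<open>The case \<open>n = 0\<close> is separate because \<open>6 * n - 1\<close> is
  truncated there and \<open>0!!\<close> stands for \<open>(-1)!!\<close>.\<close>
proof (cases n)
  case 0
  thus ?thesis by (simp add: eval_nat_numeral)
next
  case (Suc k)
  have "6 * Suc n - 1 = Suc (Suc (Suc (Suc (Suc (Suc (6*k+5))))))" "6*n - 1 = 6*k+5"
    using Suc by simp_all
  thus ?thesis using Suc by (simp only: double_fact.simps) simp
qed

lemma Z0_nth_0 [simp]: "fps_nth Z0 0 = 1"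
  by (simp add: Z0_def)

text \<open>The factor \<open>6n+3\<close> cancels against the \<open>2n+1\<close> of the factorial,
  and \<open>(6n+1)(6n+5) = 36 (n^2 + n + 5/36)\<close>.\<close>

lemma Z0_rec:
  "real (Suc n) * fps_nth Z0 (Suc n)
     = 3/2 * (real n * real n + real n + 5/36) * fps_nth Z0 n"
proof -
  define d where "d = real (double_fact (6*n-1))"
  define e where "e = (fact 3 ^ (2*n) * fact (2*n) :: real)"
  have e: "e > 0" by (simp add: e_def)
  have num: "real (double_fact (6 * Suc n - 1)) = (6*real n+5)*(6*real n+3)*(6*real n+1)*d"
    unfolding double_fact_step d_def by (simp add: algebra_simps)
  have den: "fact 3 ^ (2 * Suc n) * fact (2 * Suc n) = 36 * (2*real n+2)*(2*real n+1) * e"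
    by (simp add: e_def fact_numeral algebra_simps power2_eq_square)
  have "fps_nth Z0 (Suc n) = (6*real n+5)*(6*real n+3)*(6*real n+1)*d / (36 * (2*real n+2)*(2*real n+1) * e)"
    unfolding Z0_def fps_nth_Abs_fps num den by simp
  also have "\<dots> = (6*real n+5)*(6*real n+1) * 3 / (72 * (real n+1)) * (d / e)"
  proof -
    have "2*real n+1 > 0" "real n + 1 > 0" by auto
    thus ?thesis using e by (simp add: divide_simps)
  qed
  also have "d / e = fps_nth Z0 n" by (simp add: Z0_def d_def e_def)
  finally have 1: "fps_nth Z0 (Suc n) = (6*real n+5)*(6*real n+1) * 3 / (72 * (real n+1)) * fps_nth Z0 n" .
  show ?thesis unfolding 1 by (simp add: divide_simps) (simp add: algebra_simps)
qed

text \<open>These are the numbers \<open>p\<^sub>n\<close> above. The power of \<open>2/3\<close>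
  removes the geometric growth, that is the factor \<open>3/2\<close> of
  \<open>Z0_rec\<close>.\<close>

definition z0_coeff :: "nat \<Rightarrow> real" where
  "z0_coeff n = fps_nth Z0 n * (2/3) ^ n"

lemma z0_coeff_0 [simp]: "z0_coeff 0 = 1"
  by (simp add: z0_coeff_def)

lemma z0_coeff_rec:
  "(real n + 1) * z0_coeff (Suc n) = (real n * real n + real n + 5/36) * z0_coeff n"
proof -
  have "(real n + 1) * z0_coeff (Suc n) = (2/3) ^ Suc n * (real (Suc n) * fps_nth Z0 (Suc n))"
    by (simp add: z0_coeff_def)
  also have "\<dots> = (real n * real n + real n + 5/36) * z0_coeff n"
    unfolding Z0_rec by (simp add: z0_coeff_def)
  finally show ?thesis .
qed

lemma z0_coeff_pos: "z0_coeff n > 0"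
proof (induction n)
  case (Suc n)
  have "(real n + 1) * z0_coeff (Suc n) > 0"
    unfolding z0_coeff_rec using Suc by (intro mult_pos_pos add_nonneg_pos) auto
  thus ?case by (simp add: zero_less_mult_iff)
qed auto

text \<open>The quadratic factor of the recurrence is \<open>(n + 1/6)(n + 5/6)\<close>, so the
  coefficients are hypergeometric.\<close>

lemma z0_coeff_pochhammer: "z0_coeff n = pochhammer (1/6) n * pochhammer (5/6) n / fact n"
proof (induction n)
  case (Suc n)
  have "(real n + 1) * z0_coeff (Suc n) =
     (real n + 1) * (pochhammer (1/6) (Suc n) * pochhammer (5/6) (Suc n) / fact (Suc n))"
    unfolding z0_coeff_rec Suc by (simp add: pochhammer_rec' divide_simps) (simp add: algebra_simps)
  thus ?case by (subst (asm) mult_cancel_left) simp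
qed auto

section \<open>The growth constant \<open>1 / (2 * pi)\<close>\<close>

lemma Gamma_1_6_times_Gamma_5_6: "Gamma (1/6) * Gamma (5/6 :: real) = 2 * pi"
proof -
  have "Gamma (1/6) * Gamma (1 - 1/6 :: complex) = of_real pi / sin (of_real pi * (1/6))"
    using Gamma_reflection_complex[of "1/6"] by simp
  also have "of_real pi * (1/6) = complex_of_real (pi/6)" by simp
  also have "sin \<dots> = complex_of_real (1/2)" by (subst sin_of_real) (simp only: sin_30)
  finally have "complex_of_real (Gamma (1/6) * Gamma (5/6)) = complex_of_real (2*pi)"
    by (simp flip: Gamma_complex_of_real)
  thus ?thesis by (simp only: of_real_eq_iff)
qed

text \<open>Since \<open>1/6 + 5/6 = 1\<close>, the powers of \<open>n\<close> in the two Gamma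
  series multiply to \<open>n\<close>. For \<open>n > 0\<close> their product is
  \<open>n! (n-1)!\<close> over the two rising factorials, the reciprocal of the sequence in
  question.\<close>

lemma z0_coeff_over_Gamma_tendsto:
  "(\<lambda>n. z0_coeff n / Gamma (real n)) \<longlonglongrightarrow> 1 / (2 * pi)"
proof -
  have "(\<lambda>n. Gamma_series' (1/6) n * Gamma_series' (5/6) n :: real) \<longlonglongrightarrow> Gamma (1/6) * Gamma (5/6)"
    by (intro tendsto_mult Gamma_series'_LIMSEQ)
  hence "(\<lambda>n. 1 / (Gamma_series' (1/6) n * Gamma_series' (5/6) n :: real)) \<longlonglongrightarrow> 1 / (2*pi)"
    unfolding Gamma_1_6_times_Gamma_5_6 by (intro tendsto_divide tendsto_const) auto
  moreover have "eventually (\<lambda>n. 1 / (Gamma_series' (1/6) n * Gamma_series' (5/6) n :: real)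
     = z0_coeff n / Gamma (real n)) sequentially"
    using eventually_gt_at_top[of 0]
  proof eventually_elim
    case (elim n)
    then obtain k where k: "n = Suc k" by (cases n) auto
    have "exp (ln (real n) / 6) * exp (5 * ln (real n) / 6) = real n"
      using elim by (simp flip: exp_add)
    moreover have "Gamma (real n) = fact k"
      using k Gamma_fact[of k, where ?'a = real] by (simp add: add.commute)
    moreover have "pochhammer (1/6 :: real) n > 0" "pochhammer (5/6 :: real) n > 0"
      by (auto intro: pochhammer_pos)
    ultimately show ?case using k
      by (simp add: Gamma_series'_def z0_coeff_pochhammer divide_simps)
  qed
  ultimately show ?thesis by (rule Lim_transform_eventually)
qed

section \<open>The asymptotic expansion of the coefficients of \<open>Z0\<close>\<close>

text \<open>With \<open>x = n + 1\<close>, consecutive terms have the ratio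
  \<open>(x^2 + x + 5/36) / (x^2 + x)\<close>, which exceeds 1. The sequence starts at index 1 to
  avoid the pole of \<open>Gamma\<close> at 0.\<close>

lemma incseq_z0_coeff_over_Gamma: "incseq (\<lambda>n. z0_coeff (Suc n) / Gamma (real (Suc n)))"
proof (rule incseq_SucI)
  fix n
  define x where "x = real (Suc n)"
  have x: "x > 0" and G: "Gamma x > 0" by (auto simp: x_def intro: Gamma_real_pos)
  have "z0_coeff (Suc (Suc n)) / Gamma (real (Suc (Suc n)))
      = ((x + 1) * z0_coeff (Suc (Suc n))) / ((x + 1) * x * Gamma x)"
    using x Gamma_real_step[OF x] by (simp add: x_def add.commute)
  also have "\<dots> = (x * x + x + 5/36) / (x * x + x) * (z0_coeff (Suc n) / Gamma x)"
    using z0_coeff_rec[of "Suc n", folded x_def] by (simp add: times_divide_times_eq distrib_right)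
  also have "\<dots> \<ge> 1 * (z0_coeff (Suc n) / Gamma x)"
  proof (rule mult_right_mono)
    have "x * x + x > 0" using x by (intro add_pos_pos mult_pos_pos)
    thus "1 \<le> (x * x + x + 5/36) / (x * x + x)" by simp
  qed (use G z0_coeff_pos[of "Suc n"] in auto)
  finally show "z0_coeff (Suc n) / Gamma (real (Suc n))
      \<le> z0_coeff (Suc (Suc n)) / Gamma (real (Suc (Suc n)))"
    by (simp add: x_def)
qed

text \<open>An increasing sequence stays above its first term \<open>z0_coeff 1 = 5/36\<close>. This
  controls \<open>z0_coeff\<close> in denominators.\<close>

lemma z0_coeff_lower: "n > 0 \<Longrightarrow> 5/36 * Gamma (real n) \<le> z0_coeff n"
proof -
  assume "n > 0"
  then obtain k where k: "n = Suc k" by (cases n) auto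
  have "z0_coeff (Suc 0) / Gamma (real (Suc 0)) \<le> z0_coeff (Suc k) / Gamma (real (Suc k))"
    using incseqD[OF incseq_z0_coeff_over_Gamma, of 0 k] by simp
  moreover have "z0_coeff (Suc 0) = 5/36" using z0_coeff_rec[of 0] by simp
  moreover have "Gamma (real (Suc k)) > 0" by (intro Gamma_real_pos) auto
  ultimately show ?thesis using k by (simp add: field_simps)
qed

text \<open>An increasing sequence stays below its limit.\<close>

lemma z0_coeff_upper: "n > 0 \<Longrightarrow> z0_coeff n \<le> 1 / (2*pi) * Gamma (real n)"
proof -
  assume "n > 0"
  then obtain k where k: "n = Suc k" by (cases n) auto
  have "z0_coeff (Suc k) / Gamma (real (Suc k)) \<le> 1 / (2*pi)"
    using z0_coeff_over_Gamma_tendsto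
    by (intro incseq_le[OF incseq_z0_coeff_over_Gamma] LIMSEQ_Suc)
  moreover have "Gamma (real (Suc k)) > 0" by (intro Gamma_real_pos) auto
  ultimately show ?thesis using k by (simp add: field_simps)
qed

text \<open>Truncations of the expansion of \<open>2 * pi * z0_coeff n\<close>; the signs are those
  of \<open>Z0(-\<hbar>)\<close>.\<close>

definition z0_partial :: "nat \<Rightarrow> nat \<Rightarrow> real" where
  "z0_partial R n = (\<Sum>k<R. (-1) ^ k * z0_coeff k * Gamma (real n - real k))"

text \<open>Adding the term \<open>k = R\<close> replaces the old defect by a multiple of
  \<open>R^2 + R + 5/36\<close>, because all powers of \<open>x = n - R\<close> cancel. The
  recurrence of \<open>z0_coeff\<close>, now in the summation index, turns this into the defect for
  \<open>R + 1\<close>. The bound \<open>R \<le> n\<close> keeps the arguments of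
  \<open>Gamma\<close> positive.\<close>

lemma z0_partial_rec:
  assumes "R \<le> n" "n > 0"
  shows "(real n + 1) * z0_partial R (Suc n) - (real n * real n + real n + 5/36) * z0_partial R n
     = real R * (-1) ^ R * z0_coeff R * Gamma (real n + 1 - real R)"
  using assms
proof (induction R)
  case (Suc R)
  define x where "x = real n - real R"
  have x: "x > 0" using Suc.prems by (simp add: x_def)
  have n: "real n = x + real R" by (simp add: x_def)
  have "(real n + 1) * z0_partial (Suc R) (Suc n) - (real n * real n + real n + 5/36) * z0_partial (Suc R) n
     = real R * (-1) ^ R * z0_coeff R * Gamma (x + 1)
       + (real n + 1) * ((-1) ^ R * z0_coeff R * Gamma (x + 1))
       - (real n * real n + real n + 5/36) * ((-1) ^ R * z0_coeff R * Gamma x)"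
    using Suc by (simp add: z0_partial_def x_def algebra_simps)
  also have "\<dots> = - ((-1) ^ R) * ((real R * real R + real R + 5/36) * z0_coeff R) * Gamma x"
    unfolding Gamma_real_step[OF x] n by (simp add: algebra_simps)
  also have "\<dots> = (real R + 1) * (-1) ^ Suc R * z0_coeff (Suc R) * Gamma x"
    unfolding z0_coeff_rec[symmetric] by simp
  finally show ?case by (simp add: x_def algebra_simps)
qed (simp add: z0_partial_def)

text \<open>From \<open>N\<close> on, \<open>D + u\<close> decreases and \<open>D - u\<close>
  increases, and both tend to \<open>L\<close>; hence they enclose \<open>L\<close>.\<close>

lemma tendsto_dist_le_of_telescoping:
  fixes D u :: "nat \<Rightarrow> real"
  assumes step: "\<And>n. n \<ge> N \<Longrightarrow> \<bar>D (Suc n) - D n\<bar> \<le> u n - u (Suc n)"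
    and D: "D \<longlonglongrightarrow> L" and u: "u \<longlonglongrightarrow> 0" and n: "n \<ge> N"
  shows "\<bar>D n - L\<bar> \<le> u n"
proof -
  obtain k where k: "n = k + N" using n by (metis add.commute le_Suc_ex)
  have lim: "(\<lambda>k. D (k + N) + u (k + N)) \<longlonglongrightarrow> L + 0" "(\<lambda>k. D (k + N) - u (k + N)) \<longlonglongrightarrow> L - 0"
    by (intro tendsto_intros LIMSEQ_ignore_initial_segment D u)+
  have "decseq (\<lambda>k. D (k + N) + u (k + N))"
  proof (rule decseq_SucI)
    fix n show "D (Suc n + N) + u (Suc n + N) \<le> D (n + N) + u (n + N)"
      using step[of "n + N"] by simp
  qed
  moreover have "incseq (\<lambda>k. D (k + N) - u (k + N))"
  proof (rule incseq_SucI)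
    fix n show "D (n + N) - u (n + N) \<le> D (Suc n + N) - u (Suc n + N)"
      using step[of "n + N"] by simp
  qed
  ultimately have "L \<le> D n + u n" "D n - u n \<le> L"
    using decseq_ge[OF _ lim(1), of k] incseq_le[OF _ lim(2), of k] k by auto
  thus ?thesis by (simp add: abs_le_iff)
qed

text \<open>Only the term \<open>k = 0\<close> survives division by \<open>Gamma n\<close>;
  \<open>R > 0\<close> ensures that it is present.\<close>

lemma z0_partial_over_Gamma_tendsto:
  assumes "R > 0"
  shows "(\<lambda>n. z0_partial R n / Gamma (real n)) \<longlonglongrightarrow> 1"
proof -
  have "(\<lambda>n. \<Sum>k<R. (-1) ^ k * z0_coeff k * (Gamma (real n - real k) / Gamma (real n))) \<longlonglongrightarrow>
        (\<Sum>k<R. (-1) ^ k * z0_coeff k * (if k = 0 then 1 else 0))"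
  proof (intro tendsto_sum tendsto_mult tendsto_const)
    fix k
    show "(\<lambda>n. Gamma (real n - real k) / Gamma (real n)) \<longlonglongrightarrow> (if k = 0 then 1 else 0)"
    proof (cases "k = 0")
      case True
      have "eventually (\<lambda>n. 1 = Gamma (real n) / Gamma (real n)) sequentially"
        using eventually_Gamma_pos[of 0] by eventually_elim auto
      thus ?thesis using True by (auto intro: Lim_transform_eventually[OF tendsto_const])
    next
      case False
      thus ?thesis using Gamma_ratio_tendsto_0[of "- real k" 0] by simp
    qed
  qed
  also have "(\<Sum>k<R. (-1) ^ k * z0_coeff k * (if k = 0 then 1 else 0)) = 1"
    using assms by (simp add: if_distrib sum.If_cases cong: if_cong)
  finally show ?thesis by (simp add: z0_partial_def sum_divide_distrib)
qed

lemma z0_coeff_expansion: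
  "(\<lambda>n. z0_coeff n - 1 / (2*pi) * z0_partial R n) \<in> O(\<lambda>n. Gamma (real n - real R))"
proof (cases "R = 0")
  case True
  \<comment> \<open>The empty sum has quotient 0 rather than a limit \<open>2 * pi\<close>; the
    claim is here just the upper bound on \<open>z0_coeff\<close>.\<close>
  show ?thesis
  proof (rule bigoI[of _ "1/(2*pi)"])
    show "eventually (\<lambda>n. norm (z0_coeff n - 1 / (2*pi) * z0_partial R n) \<le>
       1 / (2*pi) * norm (Gamma (real n - real R))) sequentially"
      using eventually_gt_at_top[of 0] eventually_Gamma_pos[of 0]
    proof eventually_elim
      case (elim n)
      thus ?case using z0_coeff_upper[of n] z0_coeff_pos[of n] True
        by (simp add: z0_partial_def abs_of_pos)
    qed
  qed
next
  case False
  \<comment> \<open>The factor \<open>36/5\<close> is the reciprocal of the constant in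
    \<open>z0_coeff_lower\<close>. The majorant \<open>u\<close> is chosen so that its decrements
    are \<open>C * R * Gamma (n - R) / Gamma (n + 1)\<close>, the size of the increments of
    \<open>D\<close>.\<close>
  define C where "C = 36/5 * z0_coeff R"
  have C: "C > 0" using z0_coeff_pos by (simp add: C_def)
  define D where "D = (\<lambda>n. z0_partial R n / z0_coeff n)"
  define u where "u = (\<lambda>n. C * (Gamma (real n - real R) / Gamma (real n)))"
  have D_lim: "D \<longlonglongrightarrow> 2 * pi"
  proof -
    have "(\<lambda>n. (z0_partial R n / Gamma (real n)) / (z0_coeff n / Gamma (real n))) \<longlonglongrightarrow> 1 / (1/(2*pi))"
      using False by (intro tendsto_divide z0_partial_over_Gamma_tendsto z0_coeff_over_Gamma_tendsto) auto
    moreover have "eventually (\<lambda>n. (z0_partial R n / Gamma (real n)) / (z0_coeff n / Gamma (real n)) = D n) sequentially"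
      using eventually_Gamma_pos[of 0] by eventually_elim (auto simp: D_def)
    ultimately show ?thesis using Lim_transform_eventually by fastforce
  qed
  have "u \<longlonglongrightarrow> C * 0"
    unfolding u_def using False Gamma_ratio_tendsto_0[of "- real R" 0]
    by (intro tendsto_mult tendsto_const) simp
  hence u_lim: "u \<longlonglongrightarrow> 0" by simp
  have step: "\<bar>D (Suc n) - D n\<bar> \<le> u n - u (Suc n)" if n: "n \<ge> Suc R" for n
  proof -
    define x where "x = real n - real R"
    define y where "y = real n"
    have x: "x > 0" "x \<le> y" "y > 0" using n by (auto simp: x_def y_def)
    have G: "Gamma x > 0" "Gamma y > 0" using x by (auto intro: Gamma_real_pos)
    have z: "z0_coeff (Suc n) > 0" "z0_coeff n > 0" by (rule z0_coeff_pos)+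
    have R: "real R = y - x" by (simp add: x_def y_def)
    have "D (Suc n) - D n = ((y + 1) * z0_partial R (Suc n) - ((y + 1) * z0_coeff (Suc n) / z0_coeff n) * z0_partial R n)
         / ((y + 1) * z0_coeff (Suc n))"
      unfolding D_def using z x by (simp add: divide_simps) (simp add: algebra_simps)
    also have "(y + 1) * z0_coeff (Suc n) / z0_coeff n = y * y + y + 5/36"
      using z0_coeff_rec[of n] z by (simp add: y_def)
    also have "(y + 1) * z0_partial R (Suc n) - (y * y + y + 5/36) * z0_partial R n
      = (-1) ^ R * (real R * z0_coeff R * (x * Gamma x))"
    proof -
      have "Gamma (real n + 1 - real R) = x * Gamma x"
        using Gamma_real_step[OF x(1)] by (simp add: x_def algebra_simps)
      thus ?thesis using z0_partial_rec[of R n] n by (simp add: y_def)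
    qed
    finally have "\<bar>D (Suc n) - D n\<bar> = real R * z0_coeff R * (x * Gamma x) / ((y + 1) * z0_coeff (Suc n))"
      using x G z z0_coeff_pos[of R] by (simp add: abs_mult power_abs)
    \<comment> \<open>The factor \<open>x\<close> is enlarged to \<open>y + 1\<close>, which then
      cancels, and \<open>z0_coeff_lower\<close> is applied at \<open>n + 1\<close>.\<close>
    also have "\<dots> \<le> real R * z0_coeff R * ((y + 1) * Gamma x) / ((y + 1) * (5/36 * (y * Gamma y)))"
      using x G z0_coeff_pos[of R] z0_coeff_lower[of "Suc n"] Gamma_real_step[of y] z
      by (intro frac_le mult_left_mono mult_right_mono mult_nonneg_nonneg mult_pos_pos)
         (auto simp: y_def add.commute)
    also have "\<dots> = C * (real R * Gamma x / (y * Gamma y))"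
      using x G by (simp add: C_def)
    also have "\<dots> = u n - u (Suc n)"
    proof -
      have un: "u n = C * (Gamma x / Gamma y)" by (simp add: u_def x_def y_def)
      have us: "u (Suc n) = C * (x * Gamma x / (y * Gamma y))"
      proof -
        have "Gamma (real (Suc n) - real R) = x * Gamma x" "Gamma (real (Suc n)) = y * Gamma y"
          using Gamma_real_step[of x] Gamma_real_step[of y] x by (simp_all add: x_def y_def algebra_simps)
        thus ?thesis by (simp add: u_def)
      qed
      show ?thesis unfolding R un us using x G by (simp add: left_diff_distrib right_diff_distrib diff_divide_distrib)
    qed
    finally show ?thesis .
  qed
  show ?thesis
  \<comment> \<open>One factor \<open>1/(2*pi)\<close> normalises the partial sum. The other comes
    from \<open>z0_coeff_upper\<close>, whose \<open>Gamma n\<close> cancels the denominator of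
    \<open>u\<close>.\<close>
  proof (rule bigoI[of _ "1/(2*pi) * (1/(2*pi)) * C"])
    show "eventually (\<lambda>n. norm (z0_coeff n - 1 / (2*pi) * z0_partial R n) \<le>
       1/(2*pi) * (1/(2*pi)) * C * norm (Gamma (real n - real R))) sequentially"
      using eventually_ge_at_top[of "Suc R"]
    proof eventually_elim
      case (elim n)
      have z: "z0_coeff n > 0" by (rule z0_coeff_pos)
      have G: "Gamma (real n) > 0" "Gamma (real n - real R) > 0" using elim by (auto intro: Gamma_real_pos)
      have u0: "u n \<ge> 0" using G C by (simp add: u_def)
      have "z0_coeff n - 1 / (2*pi) * z0_partial R n = - (1/(2*pi)) * (z0_coeff n * (D n - 2*pi))"
        using z by (simp add: D_def field_simps)
      hence "norm (z0_coeff n - 1 / (2*pi) * z0_partial R n) = 1/(2*pi) * (z0_coeff n * \<bar>D n - 2*pi\<bar>)"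
        using z by (simp add: abs_mult)
      also have "\<dots> \<le> 1/(2*pi) * ((1/(2*pi) * Gamma (real n)) * u n)"
        using tendsto_dist_le_of_telescoping[OF step D_lim u_lim elim] z0_coeff_upper[of n] z G u0 elim
        by (intro mult_left_mono mult_mono) auto
      also have "\<dots> = 1/(2*pi) * (1/(2*pi)) * C * norm (Gamma (real n - real R))"
        using G by (simp add: u_def)
      finally show ?case .
    qed
  qed
qed

section \<open>Closure properties of factorial expansions\<close>

lemma factorial_expansion_add:
  assumes "factorial_expansion A f \<beta> c" "factorial_expansion A g \<beta> d"
  shows "factorial_expansion A (f + g) \<beta> (\<lambda>k. c k + d k)"
  unfolding factorial_expansion_def
proof (intro conjI allI)
  show "A > 0" using assms by (simp add: factorial_expansion_def)
  fix R
  let ?e = "\<lambda>f c n. fls_nth f (int n) - (\<Sum>k<R. c k * A powr (- real n - \<beta> + real k) * Gamma (real n + \<beta> - real k))"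
  have "(\<lambda>n. ?e f c n + ?e g d n) \<in> O(\<lambda>n. A powr (- real n) * Gamma (real n + \<beta> - real R))"
    using assms by (intro sum_in_bigo(1)) (simp_all add: factorial_expansion_def)
  also have "(\<lambda>n. ?e f c n + ?e g d n) = ?e (f + g) (\<lambda>k. c k + d k)"
    by (auto simp: fun_eq_iff sum.distrib algebra_simps)
  finally show "?e (f + g) (\<lambda>k. c k + d k) \<in> O(\<lambda>n. A powr (- real n) * Gamma (real n + \<beta> - real R))" .
qed

lemma factorial_expansion_const_mult:
  assumes "factorial_expansion A f \<beta> c"
  shows "factorial_expansion A (fls_const r * f) \<beta> (\<lambda>k. r * c k)"
  unfolding factorial_expansion_def
proof (intro conjI allI)
  show "A > 0" using assms by (simp add: factorial_expansion_def)
  fix R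
  let ?e = "\<lambda>f c n. fls_nth f (int n) - (\<Sum>k<R. c k * A powr (- real n - \<beta> + real k) * Gamma (real n + \<beta> - real k))"
  have "(\<lambda>n. r * ?e f c n) \<in> O(\<lambda>n. A powr (- real n) * Gamma (real n + \<beta> - real R))"
    using assms by (cases "r = 0") (simp_all add: factorial_expansion_def)
  also have "(\<lambda>n. r * ?e f c n) = ?e (fls_const r * f) (\<lambda>k. r * c k)"
    by (auto simp: fun_eq_iff sum_distrib_left right_diff_distrib mult.assoc fls_mult_const_nth)
  finally show "?e (fls_const r * f) (\<lambda>k. r * c k) \<in> O(\<lambda>n. A powr (- real n) * Gamma (real n + \<beta> - real R))" .
qed

text \<open>Division by \<hbar> moves the index from \<open>n\<close> to \<open>n + 1\<close>. Since
  \<open>n\<close> and \<beta> enter the terms only through \<open>n + \<beta>\<close>, the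
  coefficients stay the same; the error bound changes by the constant
  \<open>A powr (-1)\<close>.\<close>

lemma factorial_expansion_X_inv_mult:
  assumes "factorial_expansion A f \<beta> c"
  shows "factorial_expansion A (fls_X_inv * f) (\<beta> + 1) c"
  unfolding factorial_expansion_def
proof (intro conjI allI)
  show "A > 0" using assms by (simp add: factorial_expansion_def)
  fix R
  let ?e = "\<lambda>f \<beta> n. fls_nth f (int n) - (\<Sum>k<R. c k * A powr (- real n - \<beta> + real k) * Gamma (real n + \<beta> - real k))"
  let ?g = "\<lambda>\<beta> n. A powr (- real n) * Gamma (real n + \<beta> - real R)"
  have "?e f \<beta> \<in> O(?g \<beta>)" using assms by (simp add: factorial_expansion_def)
  from landau_o.big.compose[OF this filterlim_Suc]
  have "(\<lambda>n. ?e f \<beta> (Suc n)) \<in> O(\<lambda>n. ?g \<beta> (Suc n))" .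
  also have "(\<lambda>n. ?g \<beta> (Suc n)) = (\<lambda>n. A powr (-1) * ?g (\<beta> + 1) n)"
  proof
    fix n
    have "- real (Suc n) = - 1 + - real n" by simp
    hence "A powr (- real (Suc n)) = A powr (-1) * A powr (- real n)" by (simp only: powr_add)
    moreover have "real (Suc n) + \<beta> - real R = real n + (\<beta> + 1) - real R" by simp
    ultimately show "?g \<beta> (Suc n) = A powr (-1) * ?g (\<beta> + 1) n" by (simp only: mult.assoc)
  qed
  also have "O(\<dots>) = O(?g (\<beta> + 1))" using \<open>A > 0\<close> by (intro landau_o.big.cmult) auto
  also have "(\<lambda>n. ?e f \<beta> (Suc n)) = ?e (fls_X_inv * f) (\<beta> + 1)"
    by (auto simp: fun_eq_iff fls_X_inv_times_conv_shift algebra_simps intro!: sum.cong)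
  finally show "?e (fls_X_inv * f) (\<beta> + 1) \<in> O(?g (\<beta> + 1))" .
qed

text \<open>This brings expansions to a common \<beta> before they are added: the sum for
  \<open>R + 1\<close> is the old sum for \<open>R\<close>. Only \<open>R = 0\<close> has no
  counterpart, and there the bound is weakened.\<close>

lemma factorial_expansion_reindex:
  assumes "factorial_expansion A f \<beta> c"
  shows "factorial_expansion A f (\<beta> + 1) (\<lambda>k. case k of 0 \<Rightarrow> 0 | Suc i \<Rightarrow> c i)"
  unfolding factorial_expansion_def
proof (intro conjI allI)
  show "A > 0" using assms by (simp add: factorial_expansion_def)
  fix R
  let ?c = "\<lambda>k. case k of 0 \<Rightarrow> 0 | Suc i \<Rightarrow> c i"
  let ?e = "\<lambda>R \<beta> c n. fls_nth f (int n) - (\<Sum>k<R. c k * A powr (- real n - \<beta> + real k) * Gamma (real n + \<beta> - real k))"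
  let ?g = "\<lambda>R \<beta> n. A powr (- real n) * Gamma (real n + \<beta> - real R)"
  have f: "?e R \<beta> c \<in> O(?g R \<beta>)" for R using assms by (simp add: factorial_expansion_def)
  show "?e R (\<beta> + 1) ?c \<in> O(?g R (\<beta> + 1))"
  proof (cases R)
    case 0
    have "?e 0 \<beta> c \<in> O(?g 0 \<beta>)" by (rule f)
    also have "?g 0 \<beta> \<in> O(?g 0 (\<beta> + 1))"
      using Gamma_smallo[of \<beta> "\<beta> + 1"] \<open>A > 0\<close> by (intro landau_o.big.mult_left) (auto intro: landau_o.small_imp_big)
    finally show ?thesis using 0 by simp
  next
    case (Suc i)
    have "?e R (\<beta> + 1) ?c = ?e i \<beta> c"
      unfolding Suc sum.lessThan_Suc_shift by (simp add: fun_eq_iff algebra_simps)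
    moreover have "?g R (\<beta> + 1) = ?g i \<beta>" by (simp add: fun_eq_iff Suc algebra_simps)
    ultimately show ?thesis using f[of i] by simp
  qed
qed

text \<open>The Euler operator \<open>\<hbar> d/d\<hbar>\<close> becomes \<open>A/\<hbar> + \<hbar> d/d\<hbar>\<close> on the side of the expansion.\<close>

lemma factorial_expansion_X_times_deriv:
  assumes "factorial_expansion A f \<beta> c"
  shows "factorial_expansion A (fls_X * fls_deriv f) (\<beta> + 1)
           (\<lambda>k. A * c k + (case k of 0 \<Rightarrow> 0 | Suc i \<Rightarrow> (real i - \<beta>) * c i))"
  unfolding factorial_expansion_def
proof (intro conjI allI)
  show A: "A > 0" using assms by (simp add: factorial_expansion_def)
  fix R
  let ?d = "\<lambda>k. A * c k + (case k of 0 \<Rightarrow> 0 | Suc i \<Rightarrow> (real i - \<beta>) * c i)"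
  define T where "T = (\<lambda>\<beta> k n. A powr (- real n - \<beta> + real k) * Gamma (real n + \<beta> - real k))"
  let ?e = "\<lambda>f \<beta> c n. fls_nth f (int n) - (\<Sum>k<R. c k * A powr (- real n - \<beta> + real k) * Gamma (real n + \<beta> - real k))"
  let ?g = "\<lambda>\<beta> n. A powr (- real n) * Gamma (real n + \<beta> - real R)"
  \<comment> \<open>Split \<open>n = x + (k - \<beta>)\<close> with
    \<open>x = n + \<beta> - k\<close>: the first part raises \<open>Gamma x\<close> to
    \<open>Gamma (x + 1)\<close>, the second leaves it as it is. Eventually \<open>x > 0\<close>, as
    the functional equation requires.\<close>
  have step: "eventually (\<lambda>n. real n * T \<beta> k n = A * T (\<beta>+1) k n + (real k - \<beta>) * T (\<beta>+1) (Suc k) n) sequentially" for k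
    using eventually_gt_at_top[of "nat \<lceil>real k - \<beta>\<rceil>"]
  proof eventually_elim
    case (elim n)
    define x where "x = real n + \<beta> - real k"
    have x: "x > 0" using elim unfolding x_def by linarith
    have "A * T (\<beta>+1) k n = A powr (1 + (- real n - (\<beta>+1) + real k)) * Gamma (x + 1)"
      using A powr_add[of A 1 "- real n - (\<beta>+1) + real k"] by (simp add: T_def x_def algebra_simps)
    also have "\<dots> = A powr (-x) * (x * Gamma x)"
      unfolding Gamma_real_step[OF x] by (simp add: x_def algebra_simps)
    finally have 1: "A * T (\<beta>+1) k n = A powr (-x) * (x * Gamma x)" .
    have 2: "T (\<beta>+1) (Suc k) n = A powr (-x) * Gamma x" "T \<beta> k n = A powr (-x) * Gamma x"
      by (simp_all add: T_def x_def algebra_simps)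
    have n: "real n = x + (real k - \<beta>)" by (simp add: x_def)
    show ?case unfolding 1 2 n by (simp add: algebra_simps)
  qed
  have "eventually (\<lambda>n. \<forall>k\<in>{..<R}. real n * T \<beta> k n = A * T (\<beta>+1) k n + (real k - \<beta>) * T (\<beta>+1) (Suc k) n) sequentially"
    by (intro eventually_ball_finite) (auto intro: step)
  hence ev: "eventually (\<lambda>n. ?e (fls_X * fls_deriv f) (\<beta>+1) ?d n =
      real n * ?e f \<beta> c n + (case R of 0 \<Rightarrow> 0 | Suc i \<Rightarrow> (real i - \<beta>) * c i) * T (\<beta>+1) R n) sequentially"
  proof eventually_elim
    case (elim n)
    have "real n * (\<Sum>k<R. c k * T \<beta> k n) = (\<Sum>k<R. c k * (A * T (\<beta>+1) k n + (real k - \<beta>) * T (\<beta>+1) (Suc k) n))"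
      unfolding sum_distrib_left using elim by (intro sum.cong) (simp_all add: mult.left_commute)
    \<comment> \<open>Regrouping by the index of \<open>T\<close> leaves one boundary term of index
      \<open>R\<close>, which is of the order of the error.\<close>
    also have "\<dots> = (\<Sum>k<R. ?d k * T (\<beta>+1) k n) + (case R of 0 \<Rightarrow> 0 | Suc i \<Rightarrow> (real i - \<beta>) * c i) * T (\<beta>+1) R n"
      by (induction R) (auto simp: algebra_simps split: nat.splits)
    finally show ?case
      by (simp add: T_def mult.assoc right_diff_distrib fls_X_times_conv_shift)
  qed
  \<comment> \<open>The same splitting of \<open>n\<close>, now as
    \<open>(n + \<beta> - R) + (R - \<beta>)\<close>, absorbs the factor \<open>n\<close> into one
    unit of \<beta>.\<close>
  have g: "(\<lambda>n. real n * ?g \<beta> n) \<in> O(?g (\<beta>+1))"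
  proof -
    have "(\<lambda>n. (real n + \<beta> - real R) * Gamma (real n + \<beta> - real R)) \<in> O(\<lambda>n. Gamma (real n + (\<beta> + 1) - real R))"
    proof (rule bigoI[of _ 1])
      show "eventually (\<lambda>n. norm ((real n + \<beta> - real R) * Gamma (real n + \<beta> - real R))
          \<le> 1 * norm (Gamma (real n + (\<beta> + 1) - real R))) sequentially"
        using eventually_gt_at_top[of "nat \<lceil>real R - \<beta>\<rceil>"]
      proof eventually_elim
        case (elim n)
        have "real n + \<beta> - real R > 0" using elim by linarith
        from Gamma_real_step[OF this] show ?case by (simp add: algebra_simps)
      qed
    qed
    moreover have "(\<lambda>n. (real R - \<beta>) * Gamma (real n + \<beta> - real R)) \<in> O(\<lambda>n. Gamma (real n + (\<beta> + 1) - real R))"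
      using landau_o.small_imp_big[OF Gamma_smallo[of "\<beta> - real R" "\<beta> + 1 - real R"]]
      by (cases "real R = \<beta>") (simp_all add: add_diff_eq)
    ultimately have "(\<lambda>n. (real n + \<beta> - real R) * Gamma (real n + \<beta> - real R) + (real R - \<beta>) * Gamma (real n + \<beta> - real R))
         \<in> O(\<lambda>n. Gamma (real n + (\<beta> + 1) - real R))"
      by (rule sum_in_bigo)
    also have "(\<lambda>n. (real n + \<beta> - real R) * Gamma (real n + \<beta> - real R) + (real R - \<beta>) * Gamma (real n + \<beta> - real R))
        = (\<lambda>n. real n * Gamma (real n + \<beta> - real R))" by (simp add: fun_eq_iff algebra_simps)
    finally have "(\<lambda>n. A powr (- real n) * (real n * Gamma (real n + \<beta> - real R))) \<in> O(?g (\<beta>+1))"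
      by (intro landau_o.big.mult_left)
    thus ?thesis by (simp add: mult_ac)
  qed
  have T: "T (\<beta>+1) R \<in> O(?g (\<beta>+1))"
  proof (rule bigoI[of _ "A powr (- (\<beta>+1) + real R)"])
    show "eventually (\<lambda>n. norm (T (\<beta>+1) R n) \<le> A powr (- (\<beta>+1) + real R) * norm (?g (\<beta>+1) n)) sequentially"
    proof (rule always_eventually, rule allI)
      fix n
      have "A powr (- real n - (\<beta>+1) + real R) = A powr (- (\<beta>+1) + real R) * A powr (- real n)"
        by (simp flip: powr_add) (simp add: algebra_simps)
      thus "norm (T (\<beta>+1) R n) \<le> A powr (- (\<beta>+1) + real R) * norm (?g (\<beta>+1) n)"
        by (simp add: T_def abs_mult)
    qed
  qed
  have "(\<lambda>n. real n * ?e f \<beta> c n) \<in> O(\<lambda>n. real n * ?g \<beta> n)"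
    using assms by (intro landau_o.big.mult_left) (auto simp: factorial_expansion_def)
  from landau_o.big_trans[OF this g]
  have "(\<lambda>n. real n * ?e f \<beta> c n + (case R of 0 \<Rightarrow> 0 | Suc i \<Rightarrow> (real i - \<beta>) * c i) * T (\<beta>+1) R n) \<in> O(?g (\<beta>+1))"
    using T by (intro sum_in_bigo) auto
  thus "?e (fls_X * fls_deriv f) (\<beta>+1) ?d \<in> O(?g (\<beta>+1))"
    by (subst landau_o.big.in_cong[OF ev])
qed

section \<open>Uniqueness of factorial expansions\<close>

text \<open>The value that \<open>asymp_op\<close> selects, named so that pairs with different
  \<beta> can be compared.\<close>

definition expansion_series :: "real \<Rightarrow> (nat \<Rightarrow> real) \<Rightarrow> real_exp_series" where
  "expansion_series \<beta> c = hbar_powr_times (- \<beta>) (real_exp_series_of (fps_to_fls (Abs_fps c)))"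

lemma expansion_series_nth: "expansion_series \<beta> c (real k - \<beta>) = c k"
  by (simp add: expansion_series_def hbar_powr_times_def real_exp_series_of_def)

lemma expansion_series_support: "expansion_series \<beta> c e \<noteq> 0 \<Longrightarrow> e \<in> range (\<lambda>k. real k - \<beta>)"
proof -
  assume "expansion_series \<beta> c e \<noteq> 0"
  hence "e + \<beta> \<in> \<int>" "\<lfloor>e + \<beta>\<rfloor> \<ge> 0"
    by (auto simp: expansion_series_def hbar_powr_times_def real_exp_series_of_def split: if_splits)
  hence "e = real (nat \<lfloor>e + \<beta>\<rfloor>) - \<beta>" by (auto elim!: Ints_cases)
  thus ?thesis by blast
qed

lemma finite_shifted_nats_atMost: "finite {e \<in> range (\<lambda>k. real k - \<beta>). e \<le> x}"
proof (rule finite_subset)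
  show "{e \<in> range (\<lambda>k. real k - \<beta>). e \<le> x} \<subseteq> (\<lambda>k. real k - \<beta>) ` {..nat \<lfloor>x + \<beta>\<rfloor>}"
    by (auto intro!: imageI simp: le_nat_iff le_floor_iff)
qed auto

text \<open>The sum runs over exponents instead of indices. The set \<open>F\<close> may contain
  exponents outside the support, where the coefficient is 0, so one \<open>F\<close> serves two
  expansions with different \<beta>.\<close>

lemma factorial_expansion_finite_sum:
  assumes FE: "factorial_expansion A f \<beta> c" and F: "finite F" "F \<subseteq> {..x}"
    and sub: "{e \<in> range (\<lambda>k. real k - \<beta>). e \<le> x} \<subseteq> F"
  shows "(\<lambda>n. fls_nth f (int n) - (\<Sum>e\<in>F. expansion_series \<beta> c e * (A powr (e - real n) * Gamma (real n - e))))
           \<in> o(\<lambda>n. A powr (- real n) * Gamma (real n - x))"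
proof -
  \<comment> \<open>This is the number of indices \<open>k\<close> with
    \<open>k - \<beta> \<le> x\<close>; \<open>nat\<close> gives 0 if there are none.\<close>
  define R where "R = nat (\<lfloor>x + \<beta>\<rfloor> + 1)"
  have R: "k < R \<longleftrightarrow> real k - \<beta> \<le> x" for k
    using le_floor_iff[of "int k" "x + \<beta>"] unfolding R_def by (auto simp: zless_nat_eq_int_zless)
  have Rx: "\<beta> - real R < - x" using R[of R] by linarith
  have outside: "expansion_series \<beta> c e = 0" if e: "e \<in> F - (\<lambda>k. real k - \<beta>) ` {..<R}" for e
  proof (rule ccontr)
    assume "expansion_series \<beta> c e \<noteq> 0"
    then obtain k where k: "e = real k - \<beta>" using expansion_series_support[of \<beta> c e] by blast
    hence "k < R" using e F by (auto simp: R)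
    thus False using e k by blast
  qed
  have "(\<Sum>e\<in>F. expansion_series \<beta> c e * (A powr (e - real n) * Gamma (real n - e)))
    = (\<Sum>k<R. c k * A powr (- real n - \<beta> + real k) * Gamma (real n + \<beta> - real k))" for n
  proof -
    have "(\<Sum>e\<in>F. expansion_series \<beta> c e * (A powr (e - real n) * Gamma (real n - e)))
      = (\<Sum>e\<in>(\<lambda>k. real k - \<beta>) ` {..<R}. expansion_series \<beta> c e * (A powr (e - real n) * Gamma (real n - e)))"
    proof (rule sum.mono_neutral_right)
      show "(\<lambda>k. real k - \<beta>) ` {..<R} \<subseteq> F" using sub by (auto simp: R)
    qed (use F outside in auto)
    also have "\<dots> = (\<Sum>k<R. c k * A powr (- real n - \<beta> + real k) * Gamma (real n + \<beta> - real k))"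
      by (subst sum.reindex) (auto simp: inj_on_def expansion_series_nth algebra_simps intro!: sum.cong)
    finally show ?thesis .
  qed
  hence "(\<lambda>n. fls_nth f (int n) - (\<Sum>e\<in>F. expansion_series \<beta> c e * (A powr (e - real n) * Gamma (real n - e))))
      \<in> O(\<lambda>n. A powr (- real n) * Gamma (real n + \<beta> - real R))"
    using FE by (simp add: factorial_expansion_def)
  also have "(\<lambda>n. A powr (- real n) * Gamma (real n + \<beta> - real R)) \<in> o(\<lambda>n. A powr (- real n) * Gamma (real n - x))"
    using Gamma_smallo[OF Rx] by (intro landau_o.small.mult_left) (simp add: algebra_simps)
  finally show ?thesis .
qed

text \<open>At the smallest exponent \<open>e0\<close> where the two series differ, subtracting the
  expansions truncated at \<open>e0\<close> leaves a nonzero multiple of one eventually positive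
  term. That multiple would be of smaller order than the term itself.\<close>

lemma factorial_expansion_unique:
  assumes FE: "factorial_expansion A f \<beta> c" "factorial_expansion A f \<beta>' c'"
  shows "expansion_series \<beta> c = expansion_series \<beta>' c'"
proof (rule ccontr)
  assume neq: "expansion_series \<beta> c \<noteq> expansion_series \<beta>' c'"
  define g g' where "g = expansion_series \<beta> c" and "g' = expansion_series \<beta>' c'"
  define G where "G = range (\<lambda>k. real k - \<beta>) \<union> range (\<lambda>k. real k - \<beta>')"
  have fin: "finite {e \<in> G. e \<le> x}" for x
  proof -
    have "{e \<in> G. e \<le> x} = {e \<in> range (\<lambda>k. real k - \<beta>). e \<le> x} \<union> {e \<in> range (\<lambda>k. real k - \<beta>'). e \<le> x}"
      by (auto simp: G_def)
    thus ?thesis using finite_shifted_nats_atMost by simp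
  qed
  have supp: "e \<in> G" if "g e \<noteq> g' e" for e
    using that expansion_series_support[of \<beta> c e] expansion_series_support[of \<beta>' c' e]
    by (cases "g e = 0") (auto simp: g_def g'_def G_def)
  obtain e1 where e1: "g e1 \<noteq> g' e1" using neq by (auto simp: g_def g'_def)
  \<comment> \<open>The cutoff at a known disagreement \<open>e1\<close> makes \<open>S\<close>
    finite, so that its minimum exists.\<close>
  define S where "S = {e. g e \<noteq> g' e \<and> e \<le> e1}"
  have S: "finite S" "S \<noteq> {}"
    using supp e1 finite_subset[OF _ fin[of e1], of S] by (auto simp: S_def)
  define e0 where "e0 = Min S"
  have e0: "g e0 \<noteq> g' e0" "e0 \<le> e1" using Min_in[OF S] by (auto simp: S_def e0_def)
  have below: "g e = g' e" if "e < e0" for e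
  proof (rule ccontr)
    assume "g e \<noteq> g' e"
    hence "e \<in> S" using that e0 by (auto simp: S_def)
    hence "e0 \<le> e" unfolding e0_def using S by simp
    thus False using that by simp
  qed
  define F where "F = {e \<in> G. e \<le> e0}"
  have F: "finite F" using fin by (simp add: F_def)
  define T where "T = (\<lambda>e n. A powr (e - real n) * Gamma (real n - e))"
  let ?h = "\<lambda>n. A powr (- real n) * Gamma (real n - e0)"
  have A: "A > 0" using FE by (simp add: factorial_expansion_def)
  have "(\<lambda>n. fls_nth f (int n) - (\<Sum>e\<in>F. g' e * T e n) - (fls_nth f (int n) - (\<Sum>e\<in>F. g e * T e n))) \<in> o(?h)"
    unfolding g_def g'_def T_def
    by (intro sum_in_smallo factorial_expansion_finite_sum FE F) (auto simp: F_def G_def)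
  also have "(\<lambda>n. fls_nth f (int n) - (\<Sum>e\<in>F. g' e * T e n) - (fls_nth f (int n) - (\<Sum>e\<in>F. g e * T e n)))
     = (\<lambda>n. (g e0 - g' e0) * A powr e0 * ?h n)"
  proof
    fix n
    have "(\<Sum>e\<in>F. g e * T e n) - (\<Sum>e\<in>F. g' e * T e n) = (\<Sum>e\<in>F. (g e - g' e) * T e n)"
      by (simp add: sum_subtractf algebra_simps)
    also have "\<dots> = (\<Sum>e\<in>{e0}. (g e - g' e) * T e n)"
      using supp[OF e0(1)] F below by (intro sum.mono_neutral_right) (use below in \<open>auto simp: F_def order.order_iff_strict\<close>)
    also have "\<dots> = (g e0 - g' e0) * A powr e0 * ?h n"
      by (simp add: T_def powr_diff powr_minus divide_inverse)
    finally show "fls_nth f (int n) - (\<Sum>e\<in>F. g' e * T e n) - (fls_nth f (int n) - (\<Sum>e\<in>F. g e * T e n))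
      = (g e0 - g' e0) * A powr e0 * ?h n" by simp
  qed
  finally have "?h \<in> o(?h)" using e0 A by simp
  hence "eventually (\<lambda>n. ?h n = 0) sequentially" by (simp add: landau_o.small_refl_iff)
  moreover have "eventually (\<lambda>n. ?h n \<noteq> 0) sequentially"
    using eventually_Gamma_pos[of "- e0"] A by (auto elim: eventually_mono)
  ultimately have "eventually (\<lambda>n::nat. False) sequentially" by eventually_elim simp
  thus False by simp
qed

lemma asymp_op_eqI:
  assumes "factorial_expansion A f \<beta> c"
  shows "asymp_op A f = expansion_series \<beta> c"
  unfolding asymp_op_def
proof (rule the_equality)
  fix g assume "\<exists>\<beta> c. factorial_expansion A f \<beta> c \<and>
     g = hbar_powr_times (- \<beta>) (real_exp_series_of (fps_to_fls (Abs_fps c)))"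
  thus "g = expansion_series \<beta> c"
    using factorial_expansion_unique[OF _ assms] by (auto simp: expansion_series_def)
qed (use assms in \<open>auto simp: expansion_series_def\<close>)

section \<open>Powers of \<open>1 - 2j\<close>\<close>

lemma one_minus_2j_powr_nth: "fps_nth (one_minus_2j_powr a) n = (-2) ^ n * (a gchoose n)"
proof -
  have eq: "- 2 * fps_X = fps_const (-2 :: real) * fps_X" by (simp add: numeral_fps_const)
  show ?thesis unfolding one_minus_2j_powr_def eq fps_nth_compose_linear by (simp add: fps_binomial_def)
qed

lemma one_minus_2j_powr_add: "one_minus_2j_powr (a + b) = one_minus_2j_powr a * one_minus_2j_powr b"
  by (simp add: one_minus_2j_powr_def fps_binomial_add_mult fps_compose_mult_distrib)

lemma one_minus_2j_powr_0 [simp]: "one_minus_2j_powr 0 = 1"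
  by (simp add: one_minus_2j_powr_def fps_binomial_0)

lemma one_minus_2j_powr_1: "one_minus_2j_powr 1 = 1 - 2 * fps_X"
  by (simp add: one_minus_2j_powr_def fps_binomial_1 fps_compose_add_distrib)

lemma one_minus_2j_powr_power: "one_minus_2j_powr a ^ n = one_minus_2j_powr (real n * a)"
  by (induction n) (simp_all add: one_minus_2j_powr_add distrib_right)

lemma inverse_one_minus_2j_powr: "inverse (one_minus_2j_powr a) = one_minus_2j_powr (- a)"
  by (rule fps_inverse_unique) (simp flip: one_minus_2j_powr_add)

lemma fps_deriv_one_minus_2j_powr:
  "fps_deriv (one_minus_2j_powr a) = fps_const (- 2 * a) * one_minus_2j_powr (a - 1)"
proof (rule fps_ext)
  fix n
  have "fps_nth (fps_deriv (one_minus_2j_powr a)) n = (-2) ^ Suc n * (of_nat (Suc n) * (a gchoose Suc n))"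
    by (simp add: one_minus_2j_powr_nth)
  thus "fps_nth (fps_deriv (one_minus_2j_powr a)) n = fps_nth (fps_const (- 2 * a) * one_minus_2j_powr (a - 1)) n"
    unfolding gbinomial_absorption by (simp add: one_minus_2j_powr_nth)
qed

section \<open>Double series in \<open>j\<close> and \<open>\<hbar>\<close>\<close>

text \<open>The double series \<open>\<Sum>\<^sub>n G\<^sub>n(j) \<hbar>\<^sup>n\<close>\<close>

definition hbar_series :: "(nat \<Rightarrow> real fps) \<Rightarrow> real fls fps" where
  "hbar_series G = Abs_fps (\<lambda>m. fps_to_fls (Abs_fps (\<lambda>n. fps_nth (G n) m)))"

lemma hbar_series_nth: "fps_nth (hbar_series G) m = fps_to_fls (Abs_fps (\<lambda>n. fps_nth (G n) m))"
  by (simp add: hbar_series_def)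

lemma hbar_series_add: "hbar_series G + hbar_series H = hbar_series (\<lambda>n. G n + H n)"
  by (intro fps_ext fls_eqI) (simp add: hbar_series_nth)

lemma fps_deriv_hbar_series: "fps_deriv (hbar_series G) = hbar_series (\<lambda>n. fps_deriv (G n))"
  by (intro fps_ext fls_eqI) (simp add: hbar_series_nth fls_mult_of_nat_nth flip: of_nat_Suc of_nat_add)

lemma series_in_j_mult_hbar_series:
  "series_in_j h * hbar_series G = hbar_series (\<lambda>n. h * G n)"
  by (intro fps_ext fls_eqI)
     (simp add: hbar_series_nth series_in_j_def fps_mult_nth fls_nth_sum fls_mult_const_nth)

lemma X_mult_hbar_series:
  "fps_const fls_X * hbar_series G = hbar_series (\<lambda>n. case n of 0 \<Rightarrow> 0 | Suc k \<Rightarrow> G k)"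
  by (intro fps_ext fls_eqI)
     (auto simp: hbar_series_nth fls_X_times_conv_shift nat_diff_distrib split: nat.splits)

lemma series_in_j_eq_hbar_series: "series_in_j h = hbar_series (\<lambda>n. if n = 0 then h else 0)"
  by (intro fps_ext fls_eqI) (simp add: hbar_series_nth series_in_j_def)

lemma series_in_j_mult: "series_in_j (a * b) = series_in_j a * series_in_j b"
  unfolding series_in_j_eq_hbar_series[of b] series_in_j_mult_hbar_series series_in_j_eq_hbar_series[of "a*b"]
  by (rule arg_cong[of _ _ hbar_series]) auto

lemma fps_deriv_series_in_j: "fps_deriv (series_in_j a) = series_in_j (fps_deriv a)"
  unfolding series_in_j_eq_hbar_series fps_deriv_hbar_series
  by (rule arg_cong[of _ _ hbar_series]) auto

lemma series_in_j_diff: "series_in_j (a - b) = series_in_j a - series_in_j b"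
  by (intro fps_ext fls_eqI) (simp add: series_in_j_def)

lemma series_in_j_minus: "series_in_j (- a) = - series_in_j a"
  by (intro fps_ext fls_eqI) (simp add: series_in_j_def)

lemma series_in_j_const: "series_in_j (fps_const c) = fps_const (fls_const c)"
  by (intro fps_ext) (simp add: series_in_j_def)

lemma series_in_j_1 [simp]: "series_in_j 1 = 1"
  using series_in_j_const[of 1] by simp

lemma series_in_j_numeral [simp]: "series_in_j (numeral k) = numeral k"
  using series_in_j_const[of "numeral k"] by (simp add: numeral_fps_const)

lemma series_in_j_X [simp]: "series_in_j fps_X = fps_X"
  by (intro fps_ext) (simp add: series_in_j_def)

lemma subst_hbar_times_eq_hbar_series:
  "subst_hbar_times F g = hbar_series (\<lambda>n. fps_const (fps_nth F n) * g ^ n)"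
  by (simp add: subst_hbar_times_def hbar_series_def)

section \<open>The differential equation\<close>

text \<open>The saddle points of \<open>-x\<^sup>2/2 + x\<^sup>3/3! + xj\<close> are \<open>x = 1 - s (1-2j)\<^bsup>1/2\<^esup>\<close>, \<open>s = 1\<close> or \<open>s = -1\<close>; the
  contribution of such a point is \<open>phi3_saddle s\<close> (up to a constant factor).\<close>

definition phi3_saddle :: "real \<Rightarrow> real fls fps" where
  "phi3_saddle s = exp_over_3hbar (fps_const s * (one_minus_2j_powr (3/2) - 1) + 3 * fps_X)
     * series_in_j (one_minus_2j_powr (- 1/4))
     * subst_hbar_times Z0 (fps_const s * one_minus_2j_powr (- 3/2))"

lemma Z_phi3_eq: "Z_phi3 = phi3_saddle 1"
  by (simp add: Z_phi3_def phi3_saddle_def inverse_one_minus_2j_powr)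

lemma inverse_3_fls_X: "1 / (3 * fls_X) = fls_const (1/3 :: real) * fls_X_inv"
proof -
  have "3 * fls_X * (fls_const (1/3 :: real) * fls_X_inv) = (fls_const 3 * fls_const (1/3)) * (fls_X * fls_X_inv :: real fls)"
    by (simp only: fls_const_numeral mult_ac)
  also have "\<dots> = 1" by (simp only: fls_const_mult_const) (simp add: fls_X_times_conv_shift)
  finally show ?thesis by (simp add: divide_simps mult.commute)
qed

lemma fps_deriv_exp_over_3hbar:
  assumes "fps_nth P 0 = 0"
  shows "fps_deriv (exp_over_3hbar P)
     = exp_over_3hbar P * (fps_const fls_X_inv * series_in_j (fps_const (1/3) * fps_deriv P))"
proof -
  let ?b = "fps_const (1 / (3 * fls_X)) * series_in_j P"
  have "fps_nth ?b 0 = 0" using assms by (simp add: series_in_j_def)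
  hence "fps_deriv (exp_over_3hbar P) = exp_over_3hbar P * fps_deriv ?b"
    by (simp add: exp_over_3hbar_def fps_compose_deriv)
  also have "fps_deriv ?b = fps_const fls_X_inv * series_in_j (fps_const (1/3) * fps_deriv P)"
    by (simp add: fps_deriv_series_in_j inverse_3_fls_X series_in_j_mult series_in_j_const mult.left_commute
          flip: fps_const_mult)
  finally show ?thesis .
qed

text \<open>The coefficient of \<open>\<hbar>^n\<close> in \<open>S\<close> is a multiple of
  \<open>(1-2j)^(-3n/2)\<close>, so each side has a single power of \<open>1-2j\<close> in every
  order of \<hbar>. Comparing the factors gives exactly the recurrence of \<open>Z0\<close>.\<close>

lemma phi3_saddle_amplitude_ode:
  fixes s :: real
  assumes s: "s * s = 1"
  defines "S \<equiv> subst_hbar_times Z0 (fps_const s * one_minus_2j_powr (- 3/2))"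
  defines "Y \<equiv> series_in_j (one_minus_2j_powr (1/2))" and "V \<equiv> series_in_j (one_minus_2j_powr (-1/2))"
  shows "fps_const fls_X * (5 * V^4 * S + 4 * V^2 * fps_deriv S + 4 * fps_deriv (fps_deriv S))
      = 8 * series_in_j (fps_const s) * Y * fps_deriv S"
proof -
  define p where "p = one_minus_2j_powr"
  define a where "a = (\<lambda>n. fps_nth Z0 n * s ^ n)"
  define G where "G = (\<lambda>n. fps_const (a n) * p (- 3/2 * real n))"
  have S: "S = hbar_series G"
    unfolding S_def subst_hbar_times_eq_hbar_series G_def p_def a_def
    by (rule arg_cong[of _ _ hbar_series])
       (auto simp: fun_eq_iff power_mult_distrib one_minus_2j_powr_power fps_const_power mult_ac simp flip: fps_const_mult)
  have p_mult: "p x * p y = p (x + y)" for x y by (simp add: p_def one_minus_2j_powr_add)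
  have p_deriv: "fps_deriv (p x) = fps_const (- 2 * x) * p (x - 1)" for x
    by (simp add: p_def fps_deriv_one_minus_2j_powr)
  have G': "fps_deriv (G n) = fps_const (3 * real n * a n) * p (- 3/2 * real n - 1)" for n
    by (simp add: G_def p_deriv mult_ac)
  have G'': "fps_deriv (fps_deriv (G n)) = fps_const (3 * real n * (3 * real n + 2) * a n) * p (- 3/2 * real n - 2)" for n
    by (simp add: G' p_deriv algebra_simps)
  have a_rec: "24 * (real n + 1) * a (Suc n) * s = 36 * (real n * real n + real n + 5/36) * a n" for n
  proof -
    have "24 * (real n + 1) * a (Suc n) * s = 24 * (real (Suc n) * fps_nth Z0 (Suc n)) * (s ^ n * (s * s))"
      by (simp add: a_def)
    thus ?thesis unfolding Z0_rec s by (simp add: a_def algebra_simps)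
  qed
  have V: "V^2 = series_in_j (p (-1))" "V^4 = series_in_j (p (-2))"
    using p_mult[of "-1/2" "-1/2"] p_mult[of "-1" "-1"]
    by (simp_all add: V_def p_def power2_eq_square power4_eq_xxxx mult.assoc flip: series_in_j_mult)
  have lhs: "5 * V^4 * S + 4 * V^2 * fps_deriv S + 4 * fps_deriv (fps_deriv S)
     = hbar_series (\<lambda>n. fps_const (36 * (real n * real n + real n + 5/36) * a n) * p (- 3/2 * real n - 2))"
  proof -
    have "5 * V^4 * S + 4 * V^2 * fps_deriv S + 4 * fps_deriv (fps_deriv S)
      = hbar_series (\<lambda>n. 5 * p (-2) * G n + 4 * p (-1) * fps_deriv (G n) + 4 * fps_deriv (fps_deriv (G n)))"
      unfolding V S fps_deriv_hbar_series hbar_series_add[symmetric] series_in_j_mult_hbar_series[symmetric]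
      by (simp add: series_in_j_mult flip: series_in_j_numeral series_in_j_mult_hbar_series)
    also have "(\<lambda>n. 5 * p (-2) * G n + 4 * p (-1) * fps_deriv (G n) + 4 * fps_deriv (fps_deriv (G n)))
       = (\<lambda>n. fps_const (36 * (real n * real n + real n + 5/36) * a n) * p (- 3/2 * real n - 2))"
    proof
      fix n
      have 1: "p (-2) * p (- 3/2 * real n) = p (- 3/2 * real n - 2)"
         "p (-1) * p (- 3/2 * real n - 1) = p (- 3/2 * real n - 2)"
        unfolding p_mult by (auto intro!: arg_cong[of _ _ p])
      have "5 * p (-2) * G n + 4 * p (-1) * fps_deriv (G n) + 4 * fps_deriv (fps_deriv (G n))
        = (fps_const 5 * fps_const (a n)) * (p (-2) * p (- 3/2 * real n))
         + (fps_const 4 * fps_const (3 * real n * a n)) * (p (-1) * p (- 3/2 * real n - 1))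
         + (fps_const 4 * fps_const (3 * real n * (3 * real n + 2) * a n)) * p (- 3/2 * real n - 2)"
        unfolding G'' unfolding G' unfolding G_def numeral_fps_const by (simp only: mult_ac)
      also have "\<dots> = fps_const (5 * a n + 4 * (3 * real n * a n) + 4 * (3 * real n * (3 * real n + 2) * a n))
           * p (- 3/2 * real n - 2)"
        unfolding 1 by (simp only: fps_const_mult fps_const_add flip: distrib_right)
      also have "5 * a n + 4 * (3 * real n * a n) + 4 * (3 * real n * (3 * real n + 2) * a n)
          = 36 * (real n * real n + real n + 5/36) * a n"
        by (simp add: algebra_simps)
      finally show "5 * p (-2) * G n + 4 * p (-1) * fps_deriv (G n) + 4 * fps_deriv (fps_deriv (G n))
          = fps_const (36 * (real n * real n + real n + 5/36) * a n) * p (- 3/2 * real n - 2)" .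
    qed
    finally show ?thesis .
  qed
  have rhs: "8 * series_in_j (fps_const s) * Y * fps_deriv S
     = hbar_series (\<lambda>n. fps_const (24 * real n * a n * s) * p (- 3/2 * real n - 1/2))"
  proof -
    have "8 * series_in_j (fps_const s) * Y * fps_deriv S
       = hbar_series (\<lambda>n. 8 * fps_const s * p (1/2) * fps_deriv (G n))"
      unfolding Y_def S fps_deriv_hbar_series series_in_j_mult_hbar_series[symmetric] p_def
      by (simp add: series_in_j_mult)
    also have "(\<lambda>n. 8 * fps_const s * p (1/2) * fps_deriv (G n)) = (\<lambda>n. fps_const (24 * real n * a n * s) * p (- 3/2 * real n - 1/2))"
    proof
      fix n
      have "8 * fps_const s * p (1/2) * fps_deriv (G n)
         = (fps_const 8 * fps_const s * fps_const (3 * real n * a n)) * (p (1/2) * p (- 3/2 * real n - 1))"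
        unfolding G' numeral_fps_const by (simp only: mult_ac)
      also have "p (1/2) * p (- 3/2 * real n - 1) = p (- 3/2 * real n - 1/2)"
        unfolding p_mult by (auto intro!: arg_cong[of _ _ p])
      finally show "8 * fps_const s * p (1/2) * fps_deriv (G n) = fps_const (24 * real n * a n * s) * p (- 3/2 * real n - 1/2)"
        by (simp add: mult_ac)
    qed
    finally show ?thesis .
  qed
  show ?thesis unfolding lhs rhs X_mult_hbar_series
  proof (rule arg_cong[of _ _ hbar_series], rule ext)
    fix n
    show "(case n of 0 \<Rightarrow> 0 | Suc n \<Rightarrow> fps_const (36 * (real n * real n + real n + 5/36) * a n) * p (- 3/2 * real n - 2))
       = fps_const (24 * real n * a n * s) * p (- 3/2 * real n - 1/2)"
    proof (cases n)
      case (Suc k)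
      \<comment> \<open>The factor \<hbar> on the left shifts the order by one, which aligns the
        exponents of \<open>1-2j\<close>.\<close>
      have "- 3/2 * real (Suc k) - 1/2 = - 3/2 * real k - 2" by (simp add: algebra_simps)
      thus ?thesis unfolding Suc using a_rec[of k] by (simp add: add.commute)
    qed simp
  qed
qed

text \<open>Here \<open>L\<close> is \<open>1/\<hbar>\<close>, \<open>K\<close> is the prefactor of
  the amplitude \<open>S\<close>, \<open>q/2\<close> its logarithmic derivative, and
  \<open>1 - Y^2\<close> is \<open>2j\<close>. The factors 2 and 4 clear all denominators.\<close>

lemma phi3_ode_algebra:
  fixes K K1 K2 S S1 S2 L s Y V q q1 :: "'a :: idom"
  assumes "2 * K1 = K * q" "2 * K2 = K1 * q + K * q1"
    and "q = 2 * L * (1 - s * Y) + V^2" "q1 = 2 * L * s * V + 2 * V^4"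
    and "Y * V = 1" "s^2 = 1" "5 * V^4 * S + 4 * V^2 * S1 + 4 * S2 = 8 * s * L * Y * S1"
  shows "4 * (K2 * S + 2 * K1 * S1 + K * S2) = 4 * (2 * L * (K1 * S + K * S1) - (1 - Y^2) * L^2 * (K * S))"
proof -
  \<comment> \<open>This is the equation for the prefactor alone; its excess \<open>5 * V^4\<close>
    is cancelled by the amplitude equation.\<close>
  have q: "q^2 + 2 * q1 + 4 * (1 - Y^2) * L^2 = 4 * L * q + 5 * V^4"
    using assms(3-6) by algebra
  have "4 * (K2 * S + 2 * K1 * S1 + K * S2) = 2 * (2 * K2) * S + 4 * (2 * K1) * S1 + K * (4 * S2)"
    by (simp add: algebra_simps)
  also have "2 * (2 * K2) = (2 * K1) * q + 2 * K * q1"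
    unfolding assms(2) by (simp add: algebra_simps)
  also have "4 * S2 = 8 * s * L * Y * S1 - 5 * V^4 * S - 4 * V^2 * S1"
    using assms(7) by (simp add: algebra_simps)
  also have "(2 * K1 * q + 2 * K * q1) * S + 4 * (2 * K1) * S1 + K * (8 * s * L * Y * S1 - 5 * V^4 * S - 4 * V^2 * S1)
     = K * ((q^2 + 2 * q1 + 4 * (1 - Y^2) * L^2) * S - 5 * V^4 * S - 4 * (1 - Y^2) * L^2 * S
            + 4 * (q + 2 * s * L * Y - V^2) * S1)"
    unfolding assms(1) by (simp add: algebra_simps power2_eq_square)
  also have "q + 2 * s * L * Y - V^2 = 2 * L"
    unfolding assms(3) by (simp add: algebra_simps)
  also have "K * ((q^2 + 2 * q1 + 4 * (1 - Y^2) * L^2) * S - 5 * V^4 * S - 4 * (1 - Y^2) * L^2 * S + 4 * (2 * L) * S1)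
     = 4 * L * (K * q) * S + 8 * L * K * S1 - 4 * (1 - Y^2) * L^2 * (K * S)"
    unfolding q by (simp add: algebra_simps)
  also have "K * q = 2 * K1" by (simp add: assms(1))
  also have "4 * L * (2 * K1) * S + 8 * L * K * S1 - 4 * (1 - Y^2) * L^2 * (K * S)
     = 4 * (2 * L * (K1 * S + K * S1) - (1 - Y^2) * L^2 * (K * S))"
    by (simp add: algebra_simps)
  finally show ?thesis .
qed

text \<open>With exponential \<open>E\<close>, algebraic factor \<open>B\<close> and amplitude
  \<open>S\<close>, the logarithmic derivatives of \<open>E\<close> and \<open>B\<close> are
  explicit, so the prefactor \<open>K = E * B\<close> satisfies \<open>2 K' = K q\<close>. The
  second claim records the first derivative, from which the coefficient of \<open>j\<close> is read
  off.\<close>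

lemma phi3_saddle_ode:
  assumes s: "s * s = 1"
  shows "fps_deriv (fps_deriv (phi3_saddle s)) = 2 * fps_const fls_X_inv * fps_deriv (phi3_saddle s)
           - 2 * fps_X * (fps_const fls_X_inv)^2 * phi3_saddle s" (is ?ode)
    and "2 * fps_deriv (phi3_saddle s) =
     exp_over_3hbar (fps_const s * (one_minus_2j_powr (3/2) - 1) + 3 * fps_X)
     * series_in_j (one_minus_2j_powr (- 1/4))
     * ((2 * fps_const fls_X_inv * (1 - fps_const (fls_const s) * series_in_j (one_minus_2j_powr (1/2)))
          + (series_in_j (one_minus_2j_powr (- 1/2)))^2)
        * subst_hbar_times Z0 (fps_const s * one_minus_2j_powr (- 3/2))
        + 2 * fps_deriv (subst_hbar_times Z0 (fps_const s * one_minus_2j_powr (- 3/2))))" (is ?deriv)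
proof -
  define P where "P = fps_const s * (one_minus_2j_powr (3/2) - 1) + 3 * fps_X"
  define E where "E = exp_over_3hbar P"
  define B where "B = series_in_j (one_minus_2j_powr (- 1/4))"
  define S where "S = subst_hbar_times Z0 (fps_const s * one_minus_2j_powr (- 3/2))"
  define Y where "Y = series_in_j (one_minus_2j_powr (1/2))"
  define V where "V = series_in_j (one_minus_2j_powr (-1/2))"
  define L :: "real fls fps" where "L = fps_const fls_X_inv"
  define \<sigma> where "\<sigma> = series_in_j (fps_const s)"
  define q where "q = 2 * L * (1 - \<sigma> * Y) + V^2"
  have W: "phi3_saddle s = E * B * S"
    by (simp add: phi3_saddle_def E_def P_def B_def S_def)
  have L1: "fps_const fls_X * L = 1"
    by (simp add: L_def fls_X_times_conv_shift)
  have \<sigma>1: "\<sigma>^2 = 1" unfolding \<sigma>_def power2_eq_square series_in_j_mult[symmetric] using s by simp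
  have YV: "Y * V = 1"
    unfolding Y_def V_def series_in_j_mult[symmetric] one_minus_2j_powr_add[symmetric] by simp
  have Y2: "Y^2 = 1 - 2 * fps_X"
    unfolding Y_def power2_eq_square series_in_j_mult[symmetric] one_minus_2j_powr_add[symmetric]
    by (simp add: one_minus_2j_powr_1 series_in_j_diff series_in_j_mult)
  have V2: "V^2 = series_in_j (one_minus_2j_powr (-1))"
    unfolding V_def power2_eq_square series_in_j_mult[symmetric] one_minus_2j_powr_add[symmetric] by simp
  have V3: "V^3 = series_in_j (one_minus_2j_powr (-3/2))"
    unfolding power3_eq_cube V_def series_in_j_mult[symmetric] one_minus_2j_powr_add[symmetric] by simp
  have Y': "fps_deriv Y = - V"
    by (simp add: Y_def V_def fps_deriv_series_in_j fps_deriv_one_minus_2j_powr series_in_j_minus flip: fps_const_neg)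
  have V': "fps_deriv V = V^3"
    unfolding V3 by (simp add: V_def fps_deriv_series_in_j fps_deriv_one_minus_2j_powr)
  have B': "2 * fps_deriv B = V^2 * B"
  proof -
    have "2 * fps_deriv B = series_in_j (2 * fps_deriv (one_minus_2j_powr (-1/4)))"
      by (simp add: B_def fps_deriv_series_in_j series_in_j_mult)
    also have "2 * fps_deriv (one_minus_2j_powr (-1/4)) = fps_const (2 * (1/2)) * one_minus_2j_powr (-1 + (-1/4))"
      unfolding fps_deriv_one_minus_2j_powr by (simp add: numeral_fps_const flip: mult.assoc)
    also have "series_in_j \<dots> = V^2 * B"
      unfolding V2 B_def one_minus_2j_powr_add by (simp add: series_in_j_mult)
    finally show ?thesis .
  qed
  have E': "fps_deriv E = E * (L * (1 - \<sigma> * Y))"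
  proof -
    have "fps_const (1/3) * fps_deriv P = 1 - fps_const s * one_minus_2j_powr (1/2)"
      by (simp add: P_def fps_deriv_one_minus_2j_powr fps_eq_iff numeral_fps_const)
    hence "series_in_j (fps_const (1/3) * fps_deriv P) = 1 - \<sigma> * Y"
      by (simp add: \<sigma>_def Y_def series_in_j_diff series_in_j_mult)
    moreover have "fps_nth P 0 = 0"
      by (simp add: P_def one_minus_2j_powr_nth)
    ultimately show ?thesis unfolding E_def L_def by (simp add: fps_deriv_exp_over_3hbar)
  qed
  define K where "K = E * B"
  have K': "2 * fps_deriv K = K * q"
  proof -
    have "2 * fps_deriv K = E * (2 * fps_deriv B) + 2 * fps_deriv E * B"
      by (simp add: K_def algebra_simps)
    also have "\<dots> = K * q" unfolding E' B' by (simp add: K_def q_def algebra_simps)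
    finally show ?thesis .
  qed
  have L': "fps_deriv L = 0" and \<sigma>': "fps_deriv \<sigma> = 0"
    by (simp_all add: L_def \<sigma>_def series_in_j_const)
  have q': "fps_deriv q = 2 * L * \<sigma> * V + 2 * V^4"
  proof -
    have "fps_deriv q = 2 * L * (- (\<sigma> * fps_deriv Y)) + 2 * V * fps_deriv V"
      by (simp add: q_def L' \<sigma>' power2_eq_square)
    also have "\<dots> = 2 * L * \<sigma> * V + 2 * V^4" unfolding Y' V' by (simp add: power_numeral_reduce)
    finally show ?thesis .
  qed
  have K'': "2 * fps_deriv (fps_deriv K) = fps_deriv K * q + K * fps_deriv q"
  proof -
    have "2 * fps_deriv (fps_deriv K) = fps_deriv (2 * fps_deriv K)" by simp
    also have "\<dots> = fps_deriv K * q + K * fps_deriv q" unfolding K' by (simp add: algebra_simps)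
    finally show ?thesis .
  qed
  \<comment> \<open>Multiplication by \<open>L\<close> cancels the \<hbar> in the amplitude
    equation.\<close>
  have S'': "5 * V^4 * S + 4 * V^2 * fps_deriv S + 4 * fps_deriv (fps_deriv S) = 8 * \<sigma> * L * Y * fps_deriv S"
  proof -
    have "L * (fps_const fls_X * (5 * V^4 * S + 4 * V^2 * fps_deriv S + 4 * fps_deriv (fps_deriv S)))
       = L * (8 * \<sigma> * Y * fps_deriv S)"
      unfolding S_def V_def Y_def \<sigma>_def phi3_saddle_amplitude_ode[OF s] ..
    thus ?thesis using L1 by (simp only: mult.assoc[symmetric] mult.commute[of L] mult_1_left) (simp add: mult_ac)
  qed
  have D1: "fps_deriv (K * S) = fps_deriv K * S + K * fps_deriv S" by (simp add: add.commute)
  have D2: "fps_deriv (fps_deriv (K * S)) = fps_deriv (fps_deriv K) * S + 2 * fps_deriv K * fps_deriv S + K * fps_deriv (fps_deriv S)"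
    by (simp add: algebra_simps)
  have "4 * fps_deriv (fps_deriv (K * S)) = 4 * (2 * L * fps_deriv (K * S) - (1 - Y^2) * L^2 * (K * S))"
    unfolding D2 unfolding D1 by (rule phi3_ode_algebra[OF K' K'' q_def q' YV \<sigma>1 S''])
  hence "fps_deriv (fps_deriv (K * S)) = 2 * L * fps_deriv (K * S) - (1 - Y^2) * L^2 * (K * S)"
    by (subst (asm) mult_cancel_left) simp
  thus ?ode unfolding W K_def[symmetric] Y2 L_def by simp
  have "2 * fps_deriv (K * S) = K * (q * S + 2 * fps_deriv S)"
    using K' unfolding D1 by (simp add: algebra_simps)
  thus ?deriv
    unfolding W K_def[symmetric] q_def \<sigma>_def unfolding K_def E_def P_def B_def L_def S_def V_def Y_def series_in_j_const .
qed

text \<open>This compares the coefficients of \<open>j^m\<close> in the differential equation. The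
  right-hand side uses only constant multiples and divisions by \<hbar>, for which expansions are
  closed.\<close>

lemma phi3_saddle_rec:
  assumes s: "s * s = 1"
  shows "fps_nth (phi3_saddle s) (Suc (Suc m)) =
     fls_const (2 / (real m + 2)) * (fls_X_inv * fps_nth (phi3_saddle s) (Suc m))
     + (case m of 0 \<Rightarrow> 0 | Suc i \<Rightarrow>
         fls_const (- 2 / ((real m + 2) * (real m + 1))) * (fls_X_inv * (fls_X_inv * fps_nth (phi3_saddle s) i)))"
proof (rule fls_eqI)
  fix e
  let ?W = "phi3_saddle s"
  have "fps_nth (fps_deriv (fps_deriv ?W)) m = fps_nth (2 * fps_const fls_X_inv * fps_deriv ?W
           - 2 * fps_X * (fps_const fls_X_inv)^2 * ?W) m" by (simp only: phi3_saddle_ode(1)[OF s])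
  also have "2 * fps_const fls_X_inv * fps_deriv ?W
           - 2 * fps_X * (fps_const fls_X_inv)^2 * ?W = fps_const 2 * (fps_const fls_X_inv * fps_deriv ?W)
           - fps_const 2 * (fps_X * (fps_const fls_X_inv * (fps_const fls_X_inv * ?W)))"
    unfolding numeral_fps_const power2_eq_square by (simp only: mult_ac)
  finally have "of_nat (m+1) * (of_nat (m+2) * fps_nth ?W (m+2))
     = 2 * (fls_X_inv * (of_nat (m+1) * fps_nth ?W (m+1)))
       - 2 * (case m of 0 \<Rightarrow> 0 | Suc i \<Rightarrow> fls_X_inv * (fls_X_inv * fps_nth ?W i))"
    by (simp add: fps_X_mult_nth split: nat.splits)
  hence "fls_nth (of_nat (m+1) * (of_nat (m+2) * fps_nth ?W (m+2))) e
     = fls_nth (2 * (fls_X_inv * (of_nat (m+1) * fps_nth ?W (m+1)))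
       - 2 * (case m of 0 \<Rightarrow> 0 | Suc i \<Rightarrow> fls_X_inv * (fls_X_inv * fps_nth ?W i))) e" by simp
  hence "(real m + 1) * ((real m + 2) * fls_nth (fps_nth ?W (m+2)) e)
    = 2 * ((real m + 1) * fls_nth (fps_nth ?W (m+1)) (e+1))
      - 2 * (case m of 0 \<Rightarrow> 0 | Suc i \<Rightarrow> fls_nth (fps_nth ?W i) (e+2))"
    by (simp add: fls_mult_of_nat_nth fls_mult_of_numeral_nth fls_X_inv_times_conv_shift
         del: of_nat_add of_nat_Suc split: nat.splits) (simp add: algebra_simps)
  hence "fls_nth (fps_nth ?W (m+2)) e =
      (2 * ((real m + 1) * fls_nth (fps_nth ?W (m+1)) (e+1))
      - 2 * (case m of 0 \<Rightarrow> 0 | Suc i \<Rightarrow> fls_nth (fps_nth ?W i) (e+2))) / ((real m + 1) * (real m + 2))"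
    by (simp add: eq_divide_eq mult_ac)
  also have "\<dots> = 2 / (real m + 2) * fls_nth (fps_nth ?W (m+1)) (e+1)
      + - 2 / ((real m + 2) * (real m + 1)) * (case m of 0 \<Rightarrow> 0 | Suc i \<Rightarrow> fls_nth (fps_nth ?W i) (e+2))"
    by (simp add: diff_divide_distrib mult_ac)
  finally show "fls_nth (fps_nth ?W (Suc (Suc m))) e = fls_nth (fls_const (2 / (real m + 2)) * (fls_X_inv * fps_nth ?W (Suc m))
     + (case m of 0 \<Rightarrow> 0 | Suc i \<Rightarrow>
         fls_const (- 2 / ((real m + 2) * (real m + 1))) * (fls_X_inv * (fls_X_inv * fps_nth ?W i)))) e"
    by (simp add: fls_mult_const_nth fls_X_inv_times_conv_shift split: nat.splits)
qed

lemma phi3_saddle_nth_0: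
  "fps_nth (phi3_saddle s) 0 = fps_to_fls (Abs_fps (\<lambda>n. fps_nth Z0 n * s ^ n))"
  by (simp add: phi3_saddle_def exp_over_3hbar_def series_in_j_def subst_hbar_times_eq_hbar_series
        hbar_series_nth one_minus_2j_powr_nth fps_power_zeroth power_mult_distrib)

text \<open>At \<open>j = 0\<close> the prefactor is 1. The three summands come from the
  exponential, from \<open>(1-2j)^(-1/4)\<close>, and from the amplitude, where \<open>d/dj\<close>
  of \<open>(1-2j)^(-3n/2)\<close> gives \<open>3n\<close> and thus three times the Euler
  operator.\<close>

lemma phi3_saddle_nth_1:
  assumes s: "s * s = 1"
  shows "fps_nth (phi3_saddle s) (Suc 0) =
     fls_const (1 - s) * (fls_X_inv * fps_nth (phi3_saddle s) 0)
     + fls_const (1/2) * fps_nth (phi3_saddle s) 0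
     + fls_const 3 * (fls_X * fls_deriv (fps_nth (phi3_saddle s) 0))"
proof (rule fls_eqI)
  fix e
  let ?w = "fps_nth (phi3_saddle s) 0"
  let ?S = "subst_hbar_times Z0 (fps_const s * one_minus_2j_powr (- 3/2))"
  have S0: "fps_nth ?S 0 = ?w"
    by (simp add: phi3_saddle_nth_0 subst_hbar_times_eq_hbar_series
        hbar_series_nth one_minus_2j_powr_nth fps_power_zeroth power_mult_distrib)
  have S1: "fps_nth (fps_deriv ?S) 0 = fls_const 3 * (fls_X * fls_deriv ?w)"
  proof (rule fls_eqI)
    fix e
    have *: "fps_nth ((fps_const s * one_minus_2j_powr (- (3/2))) ^ n) (Suc 0) = 3 * (real n * s ^ n)" for n
      by (simp add: power_mult_distrib fps_const_power one_minus_2j_powr_power one_minus_2j_powr_nth)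
    show "fls_nth (fps_nth (fps_deriv ?S) 0) e = fls_nth (fls_const 3 * (fls_X * fls_deriv ?w)) e"
      by (cases e rule: int_cases) (simp_all add: phi3_saddle_nth_0 subst_hbar_times_eq_hbar_series hbar_series_nth *
           fls_X_times_conv_shift fls_mult_of_numeral_nth del: fls_const_numeral)
  qed
  have "2 * fps_nth (phi3_saddle s) (Suc 0) = fps_nth (2 * fps_deriv (phi3_saddle s)) 0"
    by (simp add: numeral_fps_const)
  also have "\<dots> = (2 * fls_X_inv * (1 - fls_const s) + 1) * ?w + 2 * (fls_const 3 * (fls_X * fls_deriv ?w))"
    unfolding phi3_saddle_ode(2)[OF s]
    by (simp add: S0[simplified] S1[simplified] numeral_fps_const series_in_j_def exp_over_3hbar_def one_minus_2j_powr_nth fps_power_zeroth)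
  also have "\<dots> = 2 * (fls_const (1 - s) * (fls_X_inv * ?w)) + ?w + 2 * (fls_const 3 * (fls_X * fls_deriv ?w))"
    by (simp add: algebra_simps flip: fls_minus_const)
  finally have "fls_nth (2 * fps_nth (phi3_saddle s) (Suc 0)) e
     = fls_nth (2 * (fls_const (1 - s) * (fls_X_inv * ?w)) + ?w + 2 * (fls_const 3 * (fls_X * fls_deriv ?w))) e"
    by simp
  thus "fls_nth (fps_nth (phi3_saddle s) (Suc 0)) e = fls_nth (fls_const (1 - s) * (fls_X_inv * ?w)
     + fls_const (1/2) * ?w + fls_const 3 * (fls_X * fls_deriv ?w)) e"
    by (simp add: fls_mult_of_numeral_nth fls_mult_const_nth del: fls_const_numeral)
qed

section \<open>Expansions given by Laurent series\<close>

text \<open>The case where \<beta> is a natural number \<open>m\<close>, so that the expansion is a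
  Laurent series \<open>g\<close>. The first clause bounds the pole order of \<open>g\<close>, so
  the \<open>c k\<close> determine all of \<open>g\<close>.\<close>

definition fls_expansion :: "real \<Rightarrow> real fls \<Rightarrow> real fls \<Rightarrow> nat \<Rightarrow> bool" where
  "fls_expansion A f g m \<longleftrightarrow> (\<forall>e. e < - int m \<longrightarrow> fls_nth g e = 0) \<and>
     factorial_expansion A f (real m) (\<lambda>k. fls_nth g (int k - int m))"

lemma fls_expansion_asymp_op:
  assumes "fls_expansion A f g m"
  shows "asymp_op A f = real_exp_series_of g"
proof -
  have "asymp_op A f = expansion_series (real m) (\<lambda>k. fls_nth g (int k - int m))"
    using assms by (intro asymp_op_eqI) (simp add: fls_expansion_def)
  also have "\<dots> = real_exp_series_of g"
  proof
    fix e
    have "e + real m \<in> \<int> \<longleftrightarrow> e \<in> \<int>"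
      using Ints_diff[of "e + real m" "real m"] by (auto intro: Ints_add)
    moreover have "fls_nth g \<lfloor>e\<rfloor> = 0" if "\<lfloor>e\<rfloor> + int m < 0"
      using assms that by (simp add: fls_expansion_def)
    ultimately show "expansion_series (real m) (\<lambda>k. fls_nth g (int k - int m)) e = real_exp_series_of g e"
      by (auto simp: expansion_series_def hbar_powr_times_def real_exp_series_of_def)
  qed
  finally show ?thesis .
qed

lemma fls_expansion_add:
  "fls_expansion A f g m \<Longrightarrow> fls_expansion A f' g' m \<Longrightarrow> fls_expansion A (f + f') (g + g') m"
  using factorial_expansion_add[of A f "real m" _ f'] by (auto simp: fls_expansion_def)

lemma fls_expansion_const_mult:
  "fls_expansion A f g m \<Longrightarrow> fls_expansion A (fls_const r * f) (fls_const r * g) m"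
  using factorial_expansion_const_mult[of A f "real m" _ r] by (auto simp: fls_expansion_def fls_mult_const_nth)

lemma fls_expansion_X_inv_mult:
  assumes "fls_expansion A f g m"
  shows "fls_expansion A (fls_X_inv * f) (fls_X_inv * g) (Suc m)"
  using assms factorial_expansion_X_inv_mult[of A f "real m"]
  by (auto simp: fls_expansion_def fls_X_inv_times_conv_shift add.commute)

lemma fls_expansion_Suc:
  assumes "fls_expansion A f g m"
  shows "fls_expansion A f g (Suc m)"
proof -
  have "(\<lambda>k. case k of 0 \<Rightarrow> 0 | Suc i \<Rightarrow> fls_nth g (int i - int m)) = (\<lambda>k. fls_nth g (int k - int (Suc m)))"
    using assms by (auto simp: fun_eq_iff fls_expansion_def split: nat.splits)
  thus ?thesis using assms factorial_expansion_reindex[of A f "real m" "\<lambda>k. fls_nth g (int k - int m)"]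
    by (auto simp: fls_expansion_def add.commute)
qed

lemma fls_expansion_X_times_deriv:
  assumes "fls_expansion A f g m"
  shows "fls_expansion A (fls_X * fls_deriv f) (fls_const A * (fls_X_inv * g) + fls_X * fls_deriv g) (Suc m)"
proof -
  let ?h = "fls_const A * (fls_X_inv * g) + fls_X * fls_deriv g"
  have h: "fls_nth ?h e = A * fls_nth g (e + 1) + of_int e * fls_nth g e" for e
    by (simp add: fls_mult_const_nth fls_X_inv_times_conv_shift fls_X_times_conv_shift)
  have "(\<lambda>k. A * fls_nth g (int k - int m) + (case k of 0 \<Rightarrow> 0 | Suc i \<Rightarrow> (real i - real m) * fls_nth g (int i - int m)))
     = (\<lambda>k. fls_nth ?h (int k - int (Suc m)))"
    unfolding h using assms by (auto simp: fun_eq_iff fls_expansion_def split: nat.splits)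
  thus ?thesis using assms factorial_expansion_X_times_deriv[of A f "real m" "\<lambda>k. fls_nth g (int k - int m)"]
    unfolding fls_expansion_def h by (auto simp: add.commute)
qed

section \<open>The asymptotic expansion of the partition function\<close>

text \<open>This is \<open>z0_coeff_expansion\<close> with the powers of \<open>2/3\<close>
  restored; its signs are the powers of \<open>s = -1\<close>.\<close>

lemma fls_expansion_phi3_saddle_0:
  "fls_expansion (2/3) (fps_nth (phi3_saddle 1) 0) (fls_const (1/(2*pi)) * fps_nth (phi3_saddle (-1)) 0) 0"
proof -
  have f: "fls_nth (fps_nth (phi3_saddle 1) 0) (int n) = (2/3) powr (- real n) * z0_coeff n" for n
    by (simp add: phi3_saddle_nth_0 z0_coeff_def powr_minus powr_realpow divide_simps)
  have c: "fls_nth (fls_const (1/(2*pi)) * fps_nth (phi3_saddle (-1)) 0) (int k) * (2/3) powr (- real n + real k)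
     = (2/3) powr (- real n) * (1/(2*pi) * ((-1) ^ k * z0_coeff k))" for k n
    unfolding powr_add
    by (simp add: phi3_saddle_nth_0 z0_coeff_def powr_realpow fls_mult_const_nth)
  have "(\<lambda>n. (2/3) powr (- real n) * (z0_coeff n - 1 / (2*pi) * z0_partial R n))
     \<in> O(\<lambda>n. (2/3) powr (- real n) * Gamma (real n - real R))" for R
    by (intro landau_o.big.mult_left z0_coeff_expansion)
  moreover have "(2/3) powr (- real n) * (z0_coeff n - 1 / (2*pi) * z0_partial R n)
     = fls_nth (fps_nth (phi3_saddle 1) 0) (int n) - (\<Sum>k<R. fls_nth (fls_const (1/(2*pi)) * fps_nth (phi3_saddle (-1)) 0) (int k)
         * (2/3) powr (- real n + real k) * Gamma (real n - real k))" for R n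
    unfolding f c by (simp add: z0_partial_def right_diff_distrib sum_distrib_left mult.assoc)
  ultimately show ?thesis
    by (simp add: fls_expansion_def factorial_expansion_def phi3_saddle_nth_0 fls_mult_const_nth)
qed

lemma fls_expansion_phi3_saddle:
  "fls_expansion (2/3) (fps_nth (phi3_saddle 1) m) (fls_const (1/(2*pi)) * fps_nth (phi3_saddle (-1)) m) m"
proof (induction m rule: less_induct)
  case (less m)
  define f where "f = fps_nth (phi3_saddle 1)"
  define g where "g = (\<lambda>m. fls_const (1/(2*pi)) * fps_nth (phi3_saddle (-1)) m)"
  have IH: "fls_expansion (2/3) (f i) (g i) i" if "i < m" for i
    using less that by (simp add: f_def g_def)
  have "fls_expansion (2/3) (f m) (g m) m"
  proof (cases m)
    case 0
    thus ?thesis using fls_expansion_phi3_saddle_0 by (simp add: f_def g_def)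
  next
    case (Suc m')
    show ?thesis
    proof (cases m')
      case 0
      have f: "f (Suc 0) = fls_const (1/2) * f 0 + fls_const 3 * (fls_X * fls_deriv (f 0))"
        by (simp add: f_def phi3_saddle_nth_1)
      \<comment> \<open>The term \<open>A/\<hbar>\<close> of the transformed Euler operator
        contributes \<open>3 * (2/3) = 2 = 1 - (-1)\<close>, exactly the exponential term that is
        present for \<open>s = -1\<close> and absent for \<open>s = 1\<close>.\<close>
      have g: "g (Suc 0) = fls_const (1/2) * g 0 + fls_const 3 * (fls_const (2/3) * (fls_X_inv * g 0) + fls_X * fls_deriv (g 0))"
        by (rule fls_eqI) (simp add: g_def phi3_saddle_nth_1 fls_mult_const_nth fls_X_inv_times_conv_shift
             fls_X_times_conv_shift algebra_simps del: fls_const_numeral fls_const_mult_const)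
      have 0: "fls_expansion (2/3) (f 0) (g 0) 0" using IH Suc by simp
      show ?thesis unfolding Suc \<open>m' = 0\<close> f g
        by (intro fls_expansion_add fls_expansion_const_mult fls_expansion_X_times_deriv
            fls_expansion_Suc[OF 0] 0)
    next
      case (Suc i)
      have m: "m = Suc (Suc i)" using \<open>m = Suc m'\<close> Suc by simp
      let ?a = "fls_const (2 / (real i + 2))" and ?b = "fls_const (- 2 / ((real i + 2) * (real i + 1)))"
      have f: "f (Suc (Suc i)) = ?a * (fls_X_inv * f (Suc i)) +
          (case i of 0 \<Rightarrow> 0 | Suc l \<Rightarrow> ?b * (fls_X_inv * (fls_X_inv * f l)))"
        unfolding f_def by (rule phi3_saddle_rec) simp
      have g: "g (Suc (Suc i)) = ?a * (fls_X_inv * g (Suc i)) +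
          (case i of 0 \<Rightarrow> 0 | Suc l \<Rightarrow> ?b * (fls_X_inv * (fls_X_inv * g l)))"
        unfolding g_def
        by (subst phi3_saddle_rec) (simp_all add: distrib_left mult.left_commute del: fls_const_mult_const split: nat.splits)
      have 1: "fls_expansion (2/3) (?a * (fls_X_inv * f (Suc i))) (?a * (fls_X_inv * g (Suc i))) (Suc (Suc i))"
        by (intro fls_expansion_const_mult fls_expansion_X_inv_mult IH) (simp add: m)
      show ?thesis
      proof (cases i)
        case 0
        show ?thesis using 1 unfolding m f g by (simp add: 0 del: of_nat_0 fls_const_numeral)
      next
        case (Suc l)
        have "fls_expansion (2/3) (?b * (fls_X_inv * (fls_X_inv * f l))) (?b * (fls_X_inv * (fls_X_inv * g l))) (Suc (Suc i))"
          \<comment> \<open>Two divisions by \<hbar> only reach pole bound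
            \<open>l + 2 = i + 1\<close>; one reindexing brings it to \<open>i + 2\<close>.\<close>
          unfolding Suc by (intro fls_expansion_Suc[of _ _ _ "Suc (Suc l)"] fls_expansion_const_mult fls_expansion_X_inv_mult IH) (simp add: m Suc)
        from fls_expansion_add[OF 1 this] show ?thesis
          unfolding m f g using Suc by simp
      qed
    qed
  qed
  thus ?case by (simp add: f_def g_def)
qed

section \<open>Derivatives at \<open>j = 0\<close> and the coefficients
  \<open>c_coeff\<close>\<close>

lemma Z_phi3_deriv0_eq: "Z_phi3_deriv0 m = fls_const (fact m) * fps_nth (phi3_saddle 1) m"
  by (simp add: Z_phi3_deriv0_def Z_phi3_eq fps_deriv_maclauren_0 fls_of_nat)

text \<open>The \<open>m\<close>-th \<open>j\<close>-derivative at 0 of the right-hand side of the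
  asymptotic formula.\<close>

definition dual_deriv0 :: "nat \<Rightarrow> real fls" where
  "dual_deriv0 m = fls_const (fact m) * (fls_const (1/(2*pi)) * fps_nth (phi3_saddle (-1)) m)"

lemma fls_expansion_Z_phi3_deriv0: "fls_expansion (2/3) (Z_phi3_deriv0 m) (dual_deriv0 m) m"
  unfolding Z_phi3_deriv0_eq dual_deriv0_def
  by (intro fls_expansion_const_mult fls_expansion_phi3_saddle)

lemma c_coeff_eq: "c_coeff m k = fls_nth (dual_deriv0 m) (int k - int m)"
  unfolding c_coeff_def hbar_powr_times_def fls_expansion_asymp_op[OF fls_expansion_Z_phi3_deriv0]
  using floor_of_int[of "int k - int m", where 'a = real]
  by (simp add: real_exp_series_of_def)

text \<open>The last coefficient is that of index \<open>k - 1\<close> for \<open>i\<close>; the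
  integer exponent also covers \<open>k = 0\<close>, where it lies below the pole bound and
  vanishes.\<close>

lemma c_coeff_rec:
  "c_coeff (Suc (Suc m)) k = 2 * c_coeff (Suc m) k
     - (case m of 0 \<Rightarrow> 0 | Suc i \<Rightarrow> 2 * real m * fls_nth (dual_deriv0 i) (int k - int m))"
proof -
  have "phi3_saddle (- 1) $ Suc (Suc m) =
     fls_const (2 / (real m + 2)) * (fls_X_inv * phi3_saddle (- 1) $ Suc m)
     + (case m of 0 \<Rightarrow> 0 | Suc i \<Rightarrow>
         fls_const (- 2 / ((real m + 2) * (real m + 1))) * (fls_X_inv * (fls_X_inv * phi3_saddle (- 1) $ i)))"
    by (rule phi3_saddle_rec) simp
  hence *: "fls_nth (phi3_saddle (- 1) $ Suc (Suc m)) (int k - int (Suc (Suc m)))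
    = 2 / (real m + 2) * fls_nth (phi3_saddle (- 1) $ Suc m) (int k - int (Suc m))
     + (case m of 0 \<Rightarrow> 0 | Suc i \<Rightarrow>
         - 2 / ((real m + 2) * (real m + 1)) * fls_nth (phi3_saddle (- 1) $ i) (int k - int m))"
    by (simp add: fls_mult_const_nth fls_X_inv_times_conv_shift diff_diff_eq add.commute split: nat.splits)
  show ?thesis
    unfolding c_coeff_eq dual_deriv0_def fls_mult_const_nth *
    by (simp add: divide_simps split: nat.splits) (simp add: algebra_simps)
qed

text \<open>From \<open>m = 2\<close> on, the leading coefficient doubles in each step. The
  correction factor changes by \<open>-(m - 2)/4\<close>, the difference of the quadratic polynomial
  at \<open>m\<close> and \<open>m - 1\<close>.\<close>

lemma c_coeff_0_1: "c_coeff m 0 = 2 ^ m / (2*pi) \<and>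
   c_coeff m 1 = 2 ^ m / (2*pi) * (- 5/24 + 3 * real m / 8 - (real m)\<^sup>2 / 8)"
proof (induction m rule: less_induct)
  case (less m)
  have Z1: "fps_nth Z0 (Suc 0) = 5/24" using Z0_rec[of 0] by simp
  consider "m = 0" | "m = 1" | i where "m = Suc (Suc i)" by (cases m; cases "m - 1") auto
  thus ?case
  proof cases
    case 1
    show ?thesis unfolding 1 c_coeff_eq
      by (simp add: dual_deriv0_def fls_mult_const_nth phi3_saddle_nth_0 Z1)
  next
    case 2
    have "phi3_saddle (-1) $ Suc 0 =
     fls_const (1 - (-1)) * (fls_X_inv * fps_nth (phi3_saddle (-1)) 0)
     + fls_const (1/2) * fps_nth (phi3_saddle (-1)) 0
     + fls_const 3 * (fls_X * fls_deriv (fps_nth (phi3_saddle (-1)) 0))"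
      by (rule phi3_saddle_nth_1) simp
    thus ?thesis unfolding 2 c_coeff_eq
      by (simp add: dual_deriv0_def fls_mult_const_nth fls_X_inv_times_conv_shift
            fls_X_times_conv_shift phi3_saddle_nth_0 Z1 divide_simps del: fls_const_numeral)
  next
    case (3 i)
    have IH: "c_coeff l 0 = 2 ^ l / (2*pi)"
      "c_coeff l 1 = 2 ^ l / (2*pi) * (- 5/24 + 3 * real l / 8 - (real l)\<^sup>2 / 8)" if "l < m" for l
      using less that by auto
    have low: "fls_nth (dual_deriv0 l) (int 0 - int (Suc l)) = 0" for l
      using fls_expansion_Z_phi3_deriv0[of l] by (simp add: fls_expansion_def)
    have hi: "fls_nth (dual_deriv0 l) (int 1 - int (Suc l)) = c_coeff l 0" for l
      by (simp add: c_coeff_eq)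
    show ?thesis
    proof (cases i)
      case 0
      thus ?thesis unfolding 3 c_coeff_rec using IH[of 1] 3 by (simp add: power2_eq_square)
    next
      case (Suc l)
      have "c_coeff m 0 = 2 * (2 ^ Suc i / (2*pi))"
        unfolding 3 c_coeff_rec using IH(1)[of "Suc i"] 3 low[of l] by (simp add: Suc)
      moreover have "c_coeff m 1 = 2 * (2 ^ Suc i / (2*pi) * (- 5/24 + 3 * real (Suc i) / 8 - (real (Suc i))\<^sup>2 / 8))
          - 2 * real i * (2 ^ l / (2*pi))"
        unfolding 3 c_coeff_rec using IH(2)[of "Suc i"] IH(1)[of l] 3 hi[of l] by (simp add: Suc)
      moreover have "2 * (2 ^ Suc i / (2*pi) * (- 5/24 + 3 * real (Suc i) / 8 - (real (Suc i))\<^sup>2 / 8))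
          - 2 * real i * (2 ^ l / (2*pi)) = 2 ^ m / (2*pi) * (- 5/24 + 3 * real m / 8 - (real m)\<^sup>2 / 8)"
        unfolding 3 Suc by (simp add: power2_eq_square field_simps)
      ultimately show ?thesis by (simp add: 3)
    qed
  qed
qed

text \<open>The error bound differs from that of \<open>factorial_expansion\<close> by the constant
  \<open>(2/3) powr (m - R)\<close>.\<close>

lemma z_phi3_expansion:
  "(\<lambda>n. z_phi3 m n
           - (\<Sum>k<R. c_coeff m k * (2/3) powr (- real m - real n + real k)
                       * Gamma (real n + real m - real k)))
         \<in> O(\<lambda>n. (2/3) powr (- real m - real n + real R) * Gamma (real n + real m - real R))"
proof -
  have "(\<lambda>n. z_phi3 m n
           - (\<Sum>k<R. c_coeff m k * (2/3) powr (- real m - real n + real k)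
                       * Gamma (real n + real m - real k)))
         \<in> O(\<lambda>n. (2/3) powr (- real n) * Gamma (real n + real m - real R))"
    using fls_expansion_Z_phi3_deriv0[of m]
    by (simp add: fls_expansion_def factorial_expansion_def c_coeff_eq z_phi3_def
          add.commute[of _ "- real m"] minus_diff_commute)
  also have "(\<lambda>n. (2/3) powr (- real n) * Gamma (real n + real m - real R)) =
     (\<lambda>n. (2/3) powr (real m - real R) * ((2/3) powr (- real m - real n + real R) * Gamma (real n + real m - real R)))"
    by (simp add: fun_eq_iff flip: mult.assoc powr_add)
  also have "O(\<dots>) = O(\<lambda>n. (2/3) powr (- real m - real n + real R) * Gamma (real n + real m - real R))"
    by (intro landau_o.big.cmult) simp
  finally show ?thesis .
qed

text \<open>Take the expansion with \<open>R = 2\<close> and divide by its leading term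
  \<open>D\<close>: the functional equation of \<open>Gamma\<close> yields
  \<open>1 / (n + m - 1)\<close> for \<open>k = 1\<close> and a quadratic denominator for the
  error.\<close>

lemma z_phi3_first_orders:
  "(\<lambda>n. z_phi3 m n
           / (2 ^ m / (2 * pi) * (2/3) powr (- real m - real n) * Gamma (real n + real m))
           - (1 + 2/3 * (- 5/24 + 3 * real m / 8 - (real m)\<^sup>2 / 8) * (1 / (real n + real m - 1))))
         \<in> O(\<lambda>n. 1 / (real n)\<^sup>2)"
proof -
  define p where "p = - 5/24 + 3 * real m / 8 - (real m)\<^sup>2 / 8"
  define D where "D = (\<lambda>n. 2 ^ m / (2 * pi) * (2/3) powr (- real m - real n) * Gamma (real n + real m))"
  let ?e = "\<lambda>n. z_phi3 m n
           - (\<Sum>k<2. c_coeff m k * (2/3) powr (- real m - real n + real k)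
                       * Gamma (real n + real m - real k))"
  let ?g = "\<lambda>n. (2/3) powr (- real m - real n + real 2) * Gamma (real n + real m - real 2)"
  have Dpos: "eventually (\<lambda>n. D n > 0) sequentially"
    using eventually_Gamma_pos[of "real m"] by eventually_elim (simp add: D_def)
  have step: "eventually (\<lambda>n. Gamma (real n + real m) = (real n + real m - 1) * Gamma (real n + real m - 1) \<and>
     Gamma (real n + real m) = (real n + real m - 1) * ((real n + real m - 2) * Gamma (real n + real m - 2))) sequentially"
    using eventually_gt_at_top[of 2]
  proof eventually_elim
    case (elim n)
    define x where "x = real n + real m - 2"
    have x: "x > 0" "real n + real m - 1 = x + 1" "real n + real m = x + 1 + 1"
      using elim by (auto simp: x_def)
    show ?case unfolding x(3) using Gamma_real_step[of x] Gamma_real_step[of "x + 1"] x(1) by (simp add: add.commute)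
  qed
  have "(\<lambda>n. ?e n / D n) \<in> O(\<lambda>n. ?g n / D n)"
    using z_phi3_expansion[of m 2] Dpos by (intro landau_o.big.divide_right) (auto elim: eventually_mono)
  also have "(\<lambda>n. ?g n / D n) \<in> O(\<lambda>n. 1 / ((real n + real m - 1) * (real n + real m - 2)))"
  proof (rule bigoI[of _ "(2/3)^2 * (2*pi) / 2^m"])
    show "eventually (\<lambda>n. norm (?g n / D n) \<le> (2/3)^2 * (2*pi) / 2^m
        * norm (1 / ((real n + real m - 1) * (real n + real m - 2)))) sequentially"
      using step eventually_gt_at_top[of 2]
    proof eventually_elim
      case (elim n)
      have pos: "real n + real m - 1 > 0" "real n + real m - 2 > 0" "Gamma (real n + real m - 2) > 0"
        using elim by (auto intro!: Gamma_real_pos)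
      have "(2/3) powr (- real m - real n + real 2) = (2/3) powr (- real m - real n) * (2/3 :: real)^2"
        unfolding powr_add by (simp add: powr_realpow)
      moreover have "Gamma (real n + real m) = (real n + real m - 1) * ((real n + real m - 2) * Gamma (real n + real m - 2))"
        using elim by blast
      ultimately have "?g n / D n = (2/3)^2 * (2*pi) / 2^m * (1 / ((real n + real m - 1) * (real n + real m - 2)))"
        using pos(1,2) less_imp_neq[OF pos(3)] by (simp add: D_def)
      thus ?case using pos by (simp add: abs_mult)
    qed
  qed
  also have "(\<lambda>n. 1 / ((real n + real m - 1) * (real n + real m - 2))) \<in> O(\<lambda>n. 1 / (real n)\<^sup>2)"
    by real_asymp
  finally have bigo: "(\<lambda>n. ?e n / D n) \<in> O(\<lambda>n. 1 / (real n)\<^sup>2)" .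
  have ev: "eventually (\<lambda>n. ?e n / D n = z_phi3 m n / D n - (1 + 2/3 * p * (1 / (real n + real m - 1)))) sequentially"
    using step Dpos eventually_gt_at_top[of 2]
  proof eventually_elim
    case (elim n)
    define x where "x = real n + real m - 1"
    have x: "x > 0" using elim by (simp add: x_def)
    have w: "(2/3) powr (- real m - real n + real 1) = (2/3) powr (- real m - real n) * (2/3 :: real)"
      unfolding powr_add by simp
    have c1: "c_coeff m 1 = 2 ^ m / (2 * pi) * p" using c_coeff_0_1[of m] by (simp add: p_def)
    have G: "Gamma (real n + real m) = x * Gamma x" using elim(1) by (simp add: x_def)
    have "c_coeff m 1 * (2/3) powr (- real m - real n + real 1) * Gamma x = D n * (2/3 * p * (1 / x))"
      unfolding w c1 D_def G using x by simp
    hence "c_coeff m 1 * (2/3) powr (- real m - real n + real 1) * Gamma (real n + real m - real 1)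
       = D n * (2/3 * p * (1 / (real n + real m - 1)))"
      by (simp add: x_def)
    moreover have "c_coeff m 0 * (2/3) powr (- real m - real n + real 0) * Gamma (real n + real m - real 0) = D n"
      using c_coeff_0_1[of m] by (simp add: D_def)
    ultimately have "?e n = z_phi3 m n - D n * (1 + 2/3 * p * (1 / (real n + real m - 1)))"
      by (simp add: numeral_2_eq_2 distrib_left)
    thus ?case using elim(2) by (simp add: diff_divide_distrib)
  qed
  have "(\<lambda>n. z_phi3 m n / D n - (1 + 2/3 * p * (1 / (real n + real m - 1)))) \<in> O(\<lambda>n. 1 / (real n)\<^sup>2)"
    by (rule iffD1[OF landau_o.big.in_cong[OF ev] bigo])
  thus ?thesis by (simp only: D_def p_def)
qed

theorem mainTheorem4:
  shows "(\<forall>m. has_factorial_expansion (2/3) (Z_phi3_deriv0 m))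
    \<and> (\<forall>m. has_factorial_expansion (2/3) (fps_nth Z_phi3 m))
    \<and> asymp_op_j (2/3) Z_phi3 = (\<lambda>m. real_exp_series_of (fps_nth
          (fps_const (fls_const (1 / (2 * pi)))
           * exp_over_3hbar (1 - one_minus_2j_powr (3/2) + 3 * fps_X)
           * series_in_j (inverse (one_minus_2j_powr (1/4)))
           * subst_hbar_times Z0 (- inverse (one_minus_2j_powr (3/2)))) m))
    \<and> fps_nth Z_phi3 0 = fps_to_fls Z0
    \<and> asymp_op (2/3) (fps_to_fls Z0)
        = real_exp_series_of (fps_to_fls (fps_const (1 / (2 * pi)) * fps_compose Z0 (- fps_X)))
    \<and> (\<forall>m R. (\<lambda>n. z_phi3 m n
           - (\<Sum>k<R. c_coeff m k * (2/3) powr (- real m - real n + real k)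
                       * Gamma (real n + real m - real k)))
         \<in> O(\<lambda>n. (2/3) powr (- real m - real n + real R) * Gamma (real n + real m - real R)))
    \<and> (\<forall>m. (\<lambda>n. z_phi3 m n
           / (2 ^ m / (2 * pi) * (2/3) powr (- real m - real n) * Gamma (real n + real m))
           - (1 + 2/3 * (- 5/24 + 3 * real m / 8 - (real m)\<^sup>2 / 8) * (1 / (real n + real m - 1))))
         \<in> O(\<lambda>n. 1 / (real n)\<^sup>2))"
proof (intro conjI)
  let ?W = "fps_const (fls_const (1 / (2 * pi)))
           * exp_over_3hbar (1 - one_minus_2j_powr (3/2) + 3 * fps_X)
           * series_in_j (inverse (one_minus_2j_powr (1/4)))
           * subst_hbar_times Z0 (- inverse (one_minus_2j_powr (3/2)))"
  \<comment> \<open>The sign changes in the claimed right-hand side amount to taking the second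
    saddle, \<open>s = -1\<close>.\<close>
  have W: "?W = fps_const (fls_const (1 / (2 * pi))) * phi3_saddle (-1)"
  proof -
    have "fps_const (-1) * x = - x" for x :: "real fps" by (simp flip: fps_const_neg)
    thus ?thesis by (simp add: phi3_saddle_def inverse_one_minus_2j_powr mult.assoc)
  qed
  show "\<forall>m. has_factorial_expansion (2/3) (Z_phi3_deriv0 m)"
    using fls_expansion_Z_phi3_deriv0 by (auto simp: has_factorial_expansion_def fls_expansion_def)
  show "\<forall>m. has_factorial_expansion (2/3) (fps_nth Z_phi3 m)"
    using fls_expansion_phi3_saddle by (auto simp: Z_phi3_eq has_factorial_expansion_def fls_expansion_def)
  show "asymp_op_j (2/3) Z_phi3 = (\<lambda>m. real_exp_series_of (fps_nth ?W m))"
    unfolding W asymp_op_j_def Z_phi3_eq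
    using fls_expansion_asymp_op[OF fls_expansion_phi3_saddle] by simp
  have Z: "fps_nth (phi3_saddle 1) 0 = fps_to_fls Z0"
    by (simp add: phi3_saddle_nth_0 fps_nth_inverse)
  thus "fps_nth Z_phi3 0 = fps_to_fls Z0" by (simp add: Z_phi3_eq)
  have "fps_nth (fps_compose Z0 (- fps_X)) n = fps_nth Z0 n * (-1) ^ n" for n
    using fps_nth_compose_linear[of Z0 "-1" n] by (simp flip: fps_const_neg)
  hence "fls_const (1/(2*pi)) * fps_nth (phi3_saddle (-1)) 0
    = fps_to_fls (fps_const (1 / (2 * pi)) * fps_compose Z0 (- fps_X))"
    by (intro fls_eqI) (simp add: phi3_saddle_nth_0 fls_mult_const_nth)
  thus "asymp_op (2/3) (fps_to_fls Z0)
        = real_exp_series_of (fps_to_fls (fps_const (1 / (2 * pi)) * fps_compose Z0 (- fps_X)))"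
    using fls_expansion_asymp_op[OF fls_expansion_phi3_saddle_0] by (simp add: Z)
qed (intro allI z_phi3_expansion z_phi3_first_orders)+

end
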